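(* Let $X \subset \mathbb{P}^{n+2}$ be a nonsingular intersection of two quadric hypersurfaces with $n\geq 3$. Then the morphism $\mu^X: X^o \to \mathcal{M}^{\rm PQ}_n$ is dominant. In particular, given any two nonsingular varieties $X, X' \subset \mathbb{P}^{n+2}$ defined as the intersections of two quadric hypersurfaces, there always exists a biholomorphic map $f:M \to M'$ between some nonempty Euclidean open subsets $M \subset X^o$ and $M' \subset (X')^o$ such that $\mu^M = \mu^{M'} \circ f$, where $\mu^M=\mu^X|_M$ and $\mu^{M'}=\mu^{X'}|_{M'}$.
   Context: Everything is over $\mathbb{C}$. Let $W$ be a complex vector space of dimension $n\ge 3$. A pencil of quadrics (pencil of quadratic forms) on $W$ is a line $\Phi$ in $\mathbb{P}(\mathrm{Sym}^2(W^* ))$. A quadratic form is degenerate if its symmetric bilinear form has nontrivial kernel; let $D\subset\mathbb{P}(\mathrm{Sym}^2(W^* ))$ be the hypersurface (of degree $n$) of degenerate forms. A pencil $\Phi$ is nonsingular if its general elements are nondegenerate and $\Phi$ meets $D$ in $n$ distinct points. The group $\mathrm{PGL}(W)$ acts on the space of pencils by pull-back, $T\cdot\Phi=T^*(\Phi)$; nonsingular pencils are exactly the stable points, and $\mathcal{M}^{\rm PQ}_n$ denotes the orbit space of nonsingular pencils modulo $\mathrm{PGL}(W)$, a Zariski open subset of the GIT quotient. It does not depend on the choice of the $n$-dimensional space $W$. The class of $\Phi$ is denoted $[\Phi]$. Let $X\subset\mathbb{P}^{n+2}=\mathbb{P}(V)$ be a nonsingular intersection of two quadric hypersurfaces (so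 $\dim X=n$), and let $\Phi_X$ be the pencil of quadratic forms on $V$ vanishing on $X$. For $x\in X$ the (projective) second fundamental form $II_{X,x}$ (obtained from the derivative of the projective Gauss map) is a pencil of quadrics on $T_x(X)$. Concretely: let $\widehat{x}\subset V$ be the line of $x$, let $x^\perp\subset V$ be the set of vectors orthogonal to $\widehat{x}$ with respect to the bilinear forms of all members of $\Phi_X$, let $W_x\subset x^\perp$ be an $n$-dimensional complement of $\widehat{x}$ in $x^\perp$, identified with $T_x(X)$; then $II_{X,x}$ is the linear system generated by the restrictions to $W_x$ of the forms in $\Phi_X$. Let $X^o\subset X$ be the Zariski open subset of points $x$ at which $II_{X,x}$ is a nonsingular pencil. The moduli map of second fundamental forms is $\mu^X:X^o\to\mathcal{M}^{\rm PQ}_n$, $x\mapsto[II_{X,x}]$. *)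

theory Defs
  imports "HOL-Analysis.Analysis"
begin

section \<open>Topologies\<close>

definition quotient_topology :: "'a topology \<Rightarrow> ('a \<Rightarrow> 'b) \<Rightarrow> 'b topology" where
  "quotient_topology T f =
     topology (\<lambda>U. U \<subseteq> f ` topspace T \<and> openin T {x \<in> topspace T. f x \<in> U})"

lemma openin_quotient_topology:
  "openin (quotient_topology T f) U \<longleftrightarrow>
     U \<subseteq> f ` topspace T \<and> openin T {x \<in> topspace T. f x \<in> U}"
proof -
  have "istopology (\<lambda>U. U \<subseteq> f ` topspace T \<and> openin T {x \<in> topspace T. f x \<in> U})"
    unfolding istopology_def
  proof (rule conjI; clarify)
    fix S U
    assume "S \<subseteq> f ` topspace T" "openin T {x \<in> topspace T. f x \<in> S}"
      "openin T {x \<in> topspace T. f x \<in> U}"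
    moreover have "{x \<in> topspace T. f x \<in> S \<inter> U} =
        {x \<in> topspace T. f x \<in> S} \<inter> {x \<in> topspace T. f x \<in> U}" by blast
    ultimately show "S \<inter> U \<subseteq> f ` topspace T \<and> openin T {x \<in> topspace T. f x \<in> S \<inter> U}"
      by auto
  next
    fix \<K>
    assume *: "\<forall>K\<in>\<K>. K \<subseteq> f ` topspace T \<and> openin T {x \<in> topspace T. f x \<in> K}"
    have "{x \<in> topspace T. f x \<in> \<Union>\<K>} = \<Union>((\<lambda>K. {x \<in> topspace T. f x \<in> K}) ` \<K>)"
      by blast
    with * show "\<Union>\<K> \<subseteq> f ` topspace T \<and> openin T {x \<in> topspace T. f x \<in> \<Union>\<K>}"
      by auto
  qed
  then show ?thesis
    by (simp add: quotient_topology_def)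
qed

lemma topspace_quotient_topology [simp]: "topspace (quotient_topology T f) = f ` topspace T"
proof -
  have "{x \<in> topspace T. f x \<in> f ` topspace T} = topspace T" by blast
  then have "openin (quotient_topology T f) (f ` topspace T)"
    by (simp add: openin_quotient_topology)
  then show ?thesis
    using openin_topspace[of "quotient_topology T f", unfolded openin_quotient_topology]
    by (intro subset_antisym openin_subset) auto
qed

lemma quotient_map_quotient_topology: "quotient_map T (quotient_topology T f) f"
  by (auto simp: quotient_map_def openin_quotient_topology)

inductive_set polynomial_maps :: "('a \<Rightarrow> complex) set \<Rightarrow> ('a \<Rightarrow> complex) set"
  for C :: "('a \<Rightarrow> complex) set" where
  coord: "c \<in> C \<Longrightarrow> c \<in> polynomial_maps C"
| const: "(\<lambda>_. a) \<in> polynomial_maps C"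
| add: "p \<in> polynomial_maps C \<Longrightarrow> q \<in> polynomial_maps C \<Longrightarrow> (\<lambda>x. p x + q x) \<in> polynomial_maps C"
| mult: "p \<in> polynomial_maps C \<Longrightarrow> q \<in> polynomial_maps C \<Longrightarrow> (\<lambda>x. p x * q x) \<in> polynomial_maps C"

text \<open>The Zariski topology of an affine space whose coordinate functions are the elements
  of \<open>C\<close>: the closed sets are the common zero sets of polynomials in \<open>C\<close>.\<close>

definition zariski_topology :: "('a \<Rightarrow> complex) set \<Rightarrow> 'a topology" where
  "zariski_topology C = topology (\<lambda>U. \<exists>P \<subseteq> polynomial_maps C. - U = {x. \<forall>p\<in>P. p x = 0})"

lemma openin_zariski_topology:
  "openin (zariski_topology C) U \<longleftrightarrow> (\<exists>P \<subseteq> polynomial_maps C. - U = {x. \<forall>p\<in>P. p x = 0})"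
proof -
  have "istopology (\<lambda>U. \<exists>P \<subseteq> polynomial_maps C. - U = {x. \<forall>p\<in>P. p x = 0})"
    unfolding istopology_def
  proof (intro conjI allI impI)
    fix S T
    assume "\<exists>P \<subseteq> polynomial_maps C. - S = {x. \<forall>p\<in>P. p x = 0}"
      and "\<exists>Q \<subseteq> polynomial_maps C. - T = {x. \<forall>q\<in>Q. q x = 0}"
    then obtain P Q where P: "P \<subseteq> polynomial_maps C" "- S = {x. \<forall>p\<in>P. p x = 0}"
      and Q: "Q \<subseteq> polynomial_maps C" "- T = {x. \<forall>q\<in>Q. q x = 0}" by blast
    let ?R = "{(\<lambda>x. p x * q x) | p q. p \<in> P \<and> q \<in> Q}"
    have "?R \<subseteq> polynomial_maps C"
      using P Q polynomial_maps.mult by blast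
    moreover have "- (S \<inter> T) = {x. \<forall>r\<in>?R. r x = 0}"
    proof -
      have "- (S \<inter> T) = - S \<union> - T" by blast
      also have "\<dots> = {x. \<forall>r\<in>?R. r x = 0}"
        unfolding P(2) Q(2)
      proof (intro equalityI subsetI)
        fix x assume x: "x \<in> {x. \<forall>r\<in>?R. r x = 0}"
        have "p x = 0 \<or> q x = 0" if "p \<in> P" "q \<in> Q" for p q
        proof -
          have "(\<lambda>x. p x * q x) \<in> ?R" using that by blast
          from bspec[OF CollectD[OF x] this] show ?thesis by simp
        qed
        then show "x \<in> {x. \<forall>p\<in>P. p x = 0} \<union> {x. \<forall>q\<in>Q. q x = 0}" by blast
      qed auto
      finally show ?thesis .
    qed
    ultimately show "\<exists>P \<subseteq> polynomial_maps C. - (S \<inter> T) = {x. \<forall>p\<in>P. p x = 0}" by blast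
  next
    fix \<K>
    assume "\<forall>K\<in>\<K>. \<exists>P \<subseteq> polynomial_maps C. - K = {x. \<forall>p\<in>P. p x = 0}"
    then have ex: "\<exists>P \<subseteq> polynomial_maps C. - K = {x. \<forall>p\<in>P. p x = 0}" if "K \<in> \<K>" for K
      using that by (rule bspec)
    define P where "P K = {p \<in> polynomial_maps C. \<forall>x\<in>- K. p x = 0}" for K
    have P: "x \<notin> K \<longleftrightarrow> (\<forall>p\<in>P K. p x = 0)" if "K \<in> \<K>" for K x
    proof -
      obtain Q where Q: "Q \<subseteq> polynomial_maps C" "- K = {x. \<forall>p\<in>Q. p x = 0}"
        using ex[OF \<open>K \<in> \<K>\<close>] by (elim exE conjE)
      have "Q \<subseteq> P K"
        unfolding P_def Q(2) using Q(1) by auto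
      moreover have "x \<notin> K \<longleftrightarrow> (\<forall>p\<in>Q. p x = 0)"
        using arg_cong[OF Q(2), of "\<lambda>S. x \<in> S"] by simp
      moreover have "p x = 0" if "x \<notin> K" "p \<in> P K" for p
        using that by (simp add: P_def)
      ultimately show ?thesis
        by (meson subsetD)
    qed
    have "- \<Union>\<K> = {x. \<forall>p\<in>\<Union>(P ` \<K>). p x = 0}"
      by (intro set_eqI) (simp add: P)
    moreover have "\<Union>(P ` \<K>) \<subseteq> polynomial_maps C"
      by (auto simp: P_def)
    ultimately show "\<exists>P \<subseteq> polynomial_maps C. - \<Union>\<K> = {x. \<forall>p\<in>P. p x = 0}"
      by (intro exI[of _ "\<Union>(P ` \<K>)"] conjI)
  qed
  then show ?thesis
    by (simp add: zariski_topology_def)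
qed

lemma topspace_zariski_topology [simp]: "topspace (zariski_topology C) = UNIV"
proof -
  have "openin (zariski_topology C) UNIV"
    unfolding openin_zariski_topology
    by (rule exI[of _ "{\<lambda>_. 1}"]) (auto intro: polynomial_maps.const)
  then show ?thesis using openin_subset by blast
qed

definition dominant_map :: "'a set \<Rightarrow> 'b topology \<Rightarrow> ('a \<Rightarrow> 'b) \<Rightarrow> bool" where
  "dominant_map S T f \<longleftrightarrow> f ` S \<subseteq> topspace T \<and> T closure_of (f ` S) = topspace T"


section \<open>Pencils of quadratic forms\<close>

definition mscale :: "complex \<Rightarrow> complex^'n^'n \<Rightarrow> complex^'n^'n" where
  "mscale c A = (\<chi> i j. c * A $ i $ j)"

global_interpretation mat: vector_space mscale
  by standard (simp_all add: mscale_def vec_eq_iff algebra_simps)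

text \<open>A quadratic form on \<open>\<complex>\<^sup>n\<close> is represented by the symmetric matrix of its polar form,
  so that the form of \<open>A\<close> is \<open>\<lambda>v. bil A v v\<close>.\<close>

definition bil :: "complex^'n^'n \<Rightarrow> complex^'n \<Rightarrow> complex^'n \<Rightarrow> complex" where
  "bil A u v = (\<Sum>i\<in>UNIV. \<Sum>j\<in>UNIV. u $ i * A $ i $ j * v $ j)"

definition quadratic_forms :: "(complex^'n^'n) set" where
  "quadratic_forms = {A. transpose A = A}"

definition degenerate :: "complex^'n^'n \<Rightarrow> bool" where
  "degenerate A \<longleftrightarrow> (\<exists>v. v \<noteq> 0 \<and> (\<forall>u. bil A u v = 0))"

definition pullback :: "complex^'k^'n \<Rightarrow> complex^'n^'n \<Rightarrow> complex^'k^'k" where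
  "pullback L A = transpose L ** A ** L"

lemma bil_pullback: "bil (pullback L A) u v = bil A (L *v u) (L *v v)"
proof -
  have *: "bil B x y = (\<Sum>i\<in>UNIV. x $ i * (B *v y) $ i)" for B :: "complex^'m^'m" and x y
    by (simp add: bil_def matrix_vector_mult_def sum_distrib_left mult.assoc)
  have "bil (pullback L A) u v =
      (\<Sum>i\<in>UNIV. u $ i * (\<Sum>k\<in>UNIV. L $ k $ i * (A *v (L *v v)) $ k))"
    unfolding * pullback_def
    by (simp add: matrix_vector_mul_assoc[symmetric] vector_matrix_mult_def mult.commute)
  also have "\<dots> = (\<Sum>k\<in>UNIV. (\<Sum>i\<in>UNIV. L $ k $ i * u $ i) * (A *v (L *v v)) $ k)"
    unfolding sum_distrib_left sum_distrib_right by (subst sum.swap) (simp add: mult_ac)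
  also have "\<dots> = bil A (L *v u) (L *v v)"
    unfolding * by (simp add: matrix_vector_mult_def[of L u])
  finally show ?thesis .
qed

text \<open>A line in the projective space of quadratic forms is given by the 2-dimensional linear
  space of forms above it.\<close>

definition is_pencil :: "(complex^'n^'n) set \<Rightarrow> bool" where
  "is_pencil \<Phi> \<longleftrightarrow> \<Phi> \<subseteq> quadratic_forms \<and> mat.subspace \<Phi> \<and> mat.dim \<Phi> = 2"

definition degenerate_points :: "(complex^'n^'n) set \<Rightarrow> (complex^'n^'n) set set" where
  "degenerate_points \<Phi> = {mat.span {A} | A. A \<in> \<Phi> \<and> A \<noteq> 0 \<and> degenerate A}"

text \<open>The general element of \<open>\<Phi>\<close> is nondegenerate iff only finitely many points of the line
  are degenerate.\<close>

definition nonsingular_pencil :: "(complex^'n^'n) set \<Rightarrow> bool" where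
  "nonsingular_pencil \<Phi> \<longleftrightarrow>
     is_pencil \<Phi> \<and> finite (degenerate_points \<Phi>) \<and> card (degenerate_points \<Phi>) = CARD('n)"

text \<open>The Grassmannian of pencils has the quotient topology of the space of bases of pencils.\<close>

definition pencil_bases :: "((complex^'n^'n) \<times> (complex^'n^'n)) set" where
  "pencil_bases = {(A, B). is_pencil (mat.span {A, B})}"

definition pair_coordinates :: "((complex^'n^'n) \<times> (complex^'n^'n) \<Rightarrow> complex) set" where
  "pair_coordinates = {\<lambda>(A, B). A $ i $ j | i j. True} \<union> {\<lambda>(A, B). B $ i $ j | i j. True}"

definition pencil_zariski :: "(complex^'n^'n) set topology" where
  "pencil_zariski =
     quotient_topology (subtopology (zariski_topology pair_coordinates) pencil_bases)
       (\<lambda>(A, B). mat.span {A, B})"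

text \<open>The orbit of \<open>\<Phi>\<close> under \<open>PGL\<close>; scalar matrices act trivially on pencils.\<close>

definition pencil_class :: "(complex^'n^'n) set \<Rightarrow> (complex^'n^'n) set set" where
  "pencil_class \<Phi> = {pullback T ` \<Phi> | T. invertible T}"

text \<open>The nonsingular pencils are the stable points, so their orbit space is a geometric quotient
  and its Zariski topology is the quotient topology.\<close>

definition moduli_PQ :: "(complex^'n^'n) set set topology" where
  "moduli_PQ = quotient_topology (subtopology pencil_zariski {\<Phi>. nonsingular_pencil \<Phi>}) pencil_class"


section \<open>Projective space\<close>

definition proj_space :: "(complex^'m) set set" where
  "proj_space = {vec.span {v} | v. v \<noteq> 0}"

definition proj_euclidean :: "(complex^'m) set topology" where
  "proj_euclidean = quotient_topology (subtopology euclidean (- {0})) (\<lambda>v. vec.span {v})"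

lemma topspace_proj_euclidean: "topspace proj_euclidean = proj_space"
  by (auto simp: proj_euclidean_def proj_space_def)

definition holomorphic_map :: "(complex^'m) set \<Rightarrow> (complex^'m \<Rightarrow> complex^'k) \<Rightarrow> bool" where
  "holomorphic_map N G \<longleftrightarrow>
     (\<forall>v\<in>N. \<exists>D. (G has_derivative D) (at v) \<and> (\<forall>c u. D (c *s u) = c *s D u))"

text \<open>A map on a complex submanifold \<open>M\<close> of projective space is holomorphic iff locally it is the
  restriction of a holomorphic map of the ambient space, i.e. has a holomorphic lift to
  homogeneous coordinates.\<close>

definition proj_holomorphic ::
    "(complex^'m) set set \<Rightarrow> ((complex^'m) set \<Rightarrow> (complex^'k) set) \<Rightarrow> bool" where
  "proj_holomorphic M f \<longleftrightarrow>
     (\<forall>v. v \<noteq> 0 \<and> vec.span {v} \<in> M \<longrightarrow>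
        (\<exists>N G. open N \<and> v \<in> N \<and> holomorphic_map N G \<and>
           (\<forall>u\<in>N. u \<noteq> 0 \<and> vec.span {u} \<in> M \<longrightarrow> G u \<noteq> 0 \<and> f (vec.span {u}) = vec.span {G u})))"

definition biholomorphic_map ::
    "(complex^'m) set set \<Rightarrow> (complex^'k) set set \<Rightarrow> ((complex^'m) set \<Rightarrow> (complex^'k) set) \<Rightarrow> bool"
  where
  "biholomorphic_map M M' f \<longleftrightarrow>
     bij_betw f M M' \<and> proj_holomorphic M f \<and> proj_holomorphic M' (inv_into M f)"


section \<open>Intersections of two quadrics and their second fundamental forms\<close>

text \<open>\<open>A *v v\<close> and \<open>B *v v\<close> are half the gradients at \<open>v\<close> of the two quadratic forms, so the last
  condition is the Jacobian criterion, for the scheme defined by the two forms, in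
  codimension 2.\<close>

definition nonsingular_intersection :: "(complex^'m) set set \<Rightarrow> bool" where
  "nonsingular_intersection X \<longleftrightarrow>
     (\<exists>A \<in> quadratic_forms. \<exists>B \<in> quadratic_forms.
        X = {x \<in> proj_space. \<forall>v\<in>x. bil A v v = 0 \<and> bil B v v = 0} \<and>
        (\<forall>x\<in>X. \<forall>v\<in>x - {0}. \<forall>s t. s *s (A *v v) + t *s (B *v v) = 0 \<longrightarrow> s = 0 \<and> t = 0))"

definition forms_vanishing_on :: "(complex^'m) set set \<Rightarrow> (complex^'m^'m) set" where
  "forms_vanishing_on X = {A \<in> quadratic_forms. \<forall>x\<in>X. \<forall>v\<in>x. bil A v v = 0}"

definition perp :: "(complex^'m) set set \<Rightarrow> (complex^'m) set \<Rightarrow> (complex^'m) set" where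
  "perp X x = {v. \<forall>A \<in> forms_vanishing_on X. \<forall>u\<in>x. bil A u v = 0}"

text \<open>\<open>L\<close> is a linear isomorphism from \<open>\<complex>\<^sup>n\<close> onto a complement \<open>W\<close> of the line \<open>x\<close> in \<open>perp X x\<close>;
  by means of \<open>L\<close> forms on \<open>W\<close> become forms on \<open>\<complex>\<^sup>n\<close>.\<close>

definition tangent_frame ::
    "(complex^'m) set set \<Rightarrow> (complex^'m) set \<Rightarrow> complex^'n^'m \<Rightarrow> bool" where
  "tangent_frame X x L \<longleftrightarrow>
     inj ((*v) L) \<and>
     (let W = range ((*v) L) in x \<inter> W = {0} \<and> {u + w | u w. u \<in> x \<and> w \<in> W} = perp X x)"

text \<open>Another choice of \<open>L\<close> (hence of the complement) changes the pencil by an element of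
  \<open>PGL\<close> only, since \<open>x\<close> is in the kernel of the restriction of every form to \<open>perp X x\<close>.\<close>

definition second_fundamental_form ::
    "(complex^'m) set set \<Rightarrow> (complex^'m) set \<Rightarrow> (complex^'n^'n) set" where
  "second_fundamental_form X x =
     mat.span (pullback (SOME L :: complex^'n^'m. tangent_frame X x L) ` forms_vanishing_on X)"

definition nonsingular_II_locus :: "'n::finite itself \<Rightarrow> (complex^'m) set set \<Rightarrow> (complex^'m) set set" where
  "nonsingular_II_locus _ X =
     {x \<in> X. nonsingular_pencil (second_fundamental_form X x :: (complex^'n^'n) set)}"

definition moduli_map ::
    "(complex^'m) set set \<Rightarrow> (complex^'m) set \<Rightarrow> (complex^'n^'n) set set" where
  "moduli_map X x = pencil_class (second_fundamental_form X x)"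

end

theory Submission
  imports Defs "HOL-Computational_Algebra.Fundamental_Theorem_Algebra"
begin

text \<open>
  A nonsingular intersection \<open>X\<close> of two quadrics in \<open>m = n + 3\<close> variables has the equations
  \<open>\<Sum> y\<^sub>i\<^sup>2 = \<Sum> l\<^sub>i y\<^sub>i\<^sup>2 = 0\<close> with distinct \<open>l\<^sub>i\<close> in suitable coordinates
  (\<open>nonsingular_intersection_diagonalizable\<close>), and the forms vanishing on \<open>X\<close> are the linear combinations
  of these two (\<open>forms_vanishing_diagonalized\<close>). Let \<open>y\<close> be a point of \<open>X\<close> with nonzero coordinates and
  consider the polynomial \<open>P(x) = \<Sum>\<^sub>i y\<^sub>i\<^sup>2 \<Prod>\<^bsub>j \<noteq> i\<^esub> (x - l\<^sub>j)\<close>. The two equations of \<open>X\<close> say exactly that the degree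
  of \<open>P\<close> is at most \<open>n\<close>. A member \<open>diag(l) - t\<close> of the pencil is degenerate on the tangent space at \<open>y\<close> iff
  \<open>P(t) = 0\<close>, because a kernel vector must be proportional to \<open>(y\<^sub>i / (l\<^sub>i - t))\<^sub>i\<close>, and this vector is
  orthogonal to \<open>y\<close> iff \<open>\<Sum> y\<^sub>i\<^sup>2 / (l\<^sub>i - t) = 0\<close>. If \<open>P\<close> has \<open>n\<close> distinct roots \<open>t\<^sub>k\<close>, these vectors form an
  orthogonal frame, and the second fundamental form at \<open>y\<close> is equivalent to the pencil spanned by the
  identity and \<open>diag(t)\<close> (\<open>second_fundamental_form_at_point\<close>). Every nonsingular pencil is equivalent to one of
  this shape (\<open>nonsingular_pencil_normal_form\<close>).

  Interpolation at the \<open>m\<close> nodes \<open>l\<^sub>i\<close> turns this around: \<open>y\<^sub>i\<^sup>2 = P(l\<^sub>i) / \<Prod>\<^bsub>j \<noteq> i\<^esub> (l\<^sub>i - l\<^sub>j)\<close>, so the squares of the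
  coordinates are in linear bijection with the polynomials of degree at most \<open>n\<close>. This has two
  consequences, which are the two halves of the theorem. Prescribing the roots and extracting square roots,
  one finds a point with any given class of second fundamental form, so the moduli map is even surjective
  (\<open>moduli_map_image\<close>). And for a second intersection, with nodes \<open>l'\<close>, the points \<open>y\<close> and \<open>y'\<close> with the same
  \<open>P\<close> have the same class, while \<open>y'\<^sub>i\<^sup>2\<close> is a quadratic form in \<open>y\<close>; local branches of its square root are
  inverse to the branches in the opposite direction, and define the biholomorphic map
  (\<open>biholomorphic_patches_exist\<close>).
\<close>

section \<open>Bilinear forms, pull-back and pencils\<close>

lemma bil_eq_sum: "bil A u v = (\<Sum>i\<in>UNIV. u $ i * (A *v v) $ i)"
  by (simp add: bil_def matrix_vector_mult_def sum_distrib_left mult.assoc)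

lemma bil_add_left: "bil A (u + u') v = bil A u v + bil A u' v"
  by (simp add: bil_eq_sum algebra_simps sum.distrib)

lemma bil_add_right: "bil A u (v + v') = bil A u v + bil A u v'"
  by (simp add: bil_eq_sum algebra_simps sum.distrib matrix_vector_right_distrib)

lemma bil_scale_left: "bil A (c *s u) v = c * bil A u v"
  by (simp add: bil_eq_sum sum_distrib_left mult.assoc)

lemma bil_scale_right: "bil A u (c *s v) = c * bil A u v"
  by (simp add: bil_eq_sum sum_distrib_left vector_scalar_commute mult_ac)

lemma bil_zero_left [simp]: "bil A 0 v = 0"
  by (simp add: bil_eq_sum)

lemma bil_zero_right [simp]: "bil A u 0 = 0"
  by (simp add: bil_eq_sum)

lemma bil_sum_left: "finite I \<Longrightarrow> bil A (\<Sum>i\<in>I. u i) v = (\<Sum>i\<in>I. bil A (u i) v)"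
  by (induction I rule: finite_induct) (auto simp: bil_add_left)

lemma bil_sum_right: "finite I \<Longrightarrow> bil A u (\<Sum>i\<in>I. v i) = (\<Sum>i\<in>I. bil A u (v i))"
  by (induction I rule: finite_induct) (auto simp: bil_add_right)

lemma bil_matrix_add: "bil (A + B) u v = bil A u v + bil B u v"
  by (simp add: bil_def algebra_simps sum.distrib)

lemma bil_mscale: "bil (mscale c A) u v = c * bil A u v"
  by (simp add: bil_def mscale_def sum_distrib_left mult_ac)

lemma bil_eigenvector: "B *v v = \<mu> *s (A *v v) \<Longrightarrow> bil B u v = \<mu> * bil A u v"
  by (simp add: bil_eq_sum sum_distrib_left mult_ac)

lemma bil_sym: "A \<in> quadratic_forms \<Longrightarrow> bil A u v = bil A v u"
proof -
  assume "A \<in> quadratic_forms"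
  then have "A $ i $ j = A $ j $ i" for i j
    by (metis (mono_tags) mem_Collect_eq quadratic_forms_def transpose_def vec_lambda_beta)
  then show ?thesis
    unfolding bil_def by (subst sum.swap) (simp add: mult_ac)
qed

lemma bil_axis_left: "bil A (axis i 1) v = (A *v v) $ i"
  by (simp add: bil_eq_sum axis_def if_distrib[of "\<lambda>x. x * _"] cong: if_cong)

lemma bil_axis: "bil A (axis i 1) (axis j 1) = A $ i $ j"
proof -
  have "(A *v axis j 1) $ i = A $ i $ j"
    by (simp add: matrix_vector_mult_def axis_def if_distrib[of "\<lambda>x. _ * x"] cong: if_cong)
  then show ?thesis by (simp only: bil_axis_left)
qed

lemma bil_left_zero_iff: "(\<forall>u. bil A u v = 0) \<longleftrightarrow> A *v v = 0"
proof
  assume "\<forall>u. bil A u v = 0"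
  then show "A *v v = 0" by (metis bil_axis_left vec_eq_iff zero_index)
qed (simp add: bil_eq_sum)

lemma degenerate_iff: "degenerate A \<longleftrightarrow> (\<exists>v. v \<noteq> 0 \<and> A *v v = 0)"
  by (simp add: degenerate_def bil_left_zero_iff)

lemma matrix_eq_bilI: "(\<And>u v. bil A u v = bil B u v) \<Longrightarrow> A = B"
  by (metis bil_axis vec_eq_iff)

lemma matrix_vector_mult_mscale: "mscale c A *v v = c *s (A *v v)"
  by (simp add: vec_eq_iff mscale_def matrix_vector_mult_def sum_distrib_left mult.assoc)

lemma pullback_add: "pullback L (A + B) = pullback L A + pullback L B"
  by (rule matrix_eq_bilI) (simp add: bil_pullback bil_matrix_add)

lemma pullback_mscale: "pullback L (mscale c A) = mscale c (pullback L A)"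
  by (rule matrix_eq_bilI) (simp add: bil_pullback bil_mscale)

lemma pullback_mult: "pullback (K ** L) A = pullback L (pullback K A)"
  by (rule matrix_eq_bilI) (simp add: bil_pullback matrix_vector_mul_assoc)

lemma pullback_one [simp]: "pullback (mat 1) A = A"
  by (rule matrix_eq_bilI) (simp add: bil_pullback)

lemma pullback_zero [simp]: "pullback L 0 = 0"
  using pullback_mscale[of L 0 0] by (simp add: mat.scale_zero_left)

lemma pullback_quadratic_form: "A \<in> quadratic_forms \<Longrightarrow> pullback L A \<in> quadratic_forms"
  by (simp add: quadratic_forms_def pullback_def matrix_transpose_mul matrix_mul_assoc)

lemma inj_pullback: "invertible T \<Longrightarrow> inj (pullback T)"
  by (metis injI invertible_def pullback_mult pullback_one)

lemma mat_span_singleton: "mat.span {A} = {mscale c A | c. True}"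
  by (auto simp: mat.span_singleton)

lemma mat_span_pair: "mat.span {A, B} = {mscale a A + mscale b B | a b. True}"
proof -
  have "mat.span {A, B} = {x. \<exists>k. x - mscale k A \<in> mat.span {B}}"
    by (rule mat.span_insert)
  also have "\<dots> = {mscale a A + mscale b B | a b. True}"
    unfolding mat.span_singleton
    by (auto simp: algebra_simps image_iff eq_diff_eq)
  finally show ?thesis .
qed

lemma span_pair_shift: "mat.span {A + mscale t B, B} = mat.span {A, B}"
proof -
  have "mscale a A + mscale b B = mscale a (A + mscale t B) + mscale (b - a * t) B" for a b
    by (simp add: mscale_def vec_eq_iff algebra_simps)
  moreover have "mscale a (A + mscale t B) + mscale b B = mscale a A + mscale (b + a * t) B" for a b
    by (simp add: mscale_def vec_eq_iff algebra_simps)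
  ultimately show ?thesis unfolding mat_span_pair by blast
qed

lemma pullback_span_singleton: "pullback L ` mat.span {A} = mat.span {pullback L A}"
  by (auto simp: mat_span_singleton pullback_mscale[symmetric])

lemma pullback_span_pair: "pullback L ` mat.span {A, B} = mat.span {pullback L A, pullback L B}"
  by (auto simp: mat_span_pair pullback_mscale[symmetric] pullback_add[symmetric])

definition cols :: "('k \<Rightarrow> complex^'m) \<Rightarrow> complex^'k^'m" where
  "cols w = (\<chi> i k. w k $ i)"

lemma cols_mult: "cols w *v u = (\<Sum>k\<in>UNIV. u $ k *s w k)"
  by (simp add: cols_def matrix_vector_mult_def vec_eq_iff mult.commute)

lemma cols_axis: "cols w *v axis k 1 = w k"
  by (simp add: vec_eq_iff cols_def matrix_vector_mult_def axis_def if_distrib[of "\<lambda>x. _ * x"] cong: if_cong)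

lemma pullback_cols: "pullback (cols w) A $ i $ j = bil A (w i) (w j)"
  by (simp flip: bil_axis add: bil_pullback cols_axis)

definition diagm :: "('k \<Rightarrow> complex) \<Rightarrow> complex^'k^'k" where
  "diagm d = (\<chi> i j. if i = j then d i else 0)"

lemma diagm_mult: "(diagm d *v v) $ i = d i * v $ i"
  by (simp add: diagm_def matrix_vector_mult_def if_distrib[of "\<lambda>x. x * _"] cong: if_cong)

lemma bil_diagm: "bil (diagm d) u v = (\<Sum>i\<in>UNIV. d i * (u $ i * v $ i))"
  by (simp add: bil_eq_sum diagm_mult mult_ac)

lemma diagm_quadratic_form [simp]: "diagm d \<in> quadratic_forms"
  by (auto simp: quadratic_forms_def diagm_def transpose_def vec_eq_iff)

lemma mscale_diagm: "mscale c (diagm d) = diagm (\<lambda>i. c * d i)"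
  by (simp add: mscale_def diagm_def vec_eq_iff)

lemma add_diagm: "diagm d + diagm e = diagm (\<lambda>i. d i + e i)"
  by (simp add: diagm_def vec_eq_iff)

lemma diagm_one: "diagm (\<lambda>_. 1) = mat 1"
  by (simp add: mat_def diagm_def)

lemma diagm_eq_iff: "diagm d = diagm e \<longleftrightarrow> d = e"
  by (auto simp: diagm_def vec_eq_iff fun_eq_iff)

lemma pullback_cols_orthogonal:
  assumes "\<And>i j. bil A (w i) (w j) = (if i = j then d i else 0)"
  shows "pullback (cols w) A = diagm d"
  by (simp add: vec_eq_iff pullback_cols assms diagm_def)

lemma invertible_if_inj: "inj ((*v) (S :: complex^'n^'n)) \<Longrightarrow> invertible S"
  using invertible_left_inverse matrix_left_invertible_injective by blast

lemma inj_if_pullback_one: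
  assumes "pullback L A = mat 1"
  shows "inj ((*v) L)"
proof (rule injI)
  fix u v assume "L *v u = L *v v"
  then have "pullback L A *v u = pullback L A *v v"
    by (simp add: pullback_def matrix_vector_mul_assoc[symmetric])
  then show "u = v" using assms by simp
qed

definition diag_pencil :: "('k \<Rightarrow> complex) \<Rightarrow> (complex^'k^'k) set" where
  "diag_pencil t = mat.span {diagm (\<lambda>_. 1), diagm t}"

lemma diag_pencil_eq: "diag_pencil t = {diagm (\<lambda>i. a + b * t i) | a b. True}"
  by (simp add: diag_pencil_def mat_span_pair mscale_diagm add_diagm)

text \<open>The roots of a pencil are only defined up to a change of basis of the pencil. Translations are enough
  to move them away from any finite set.\<close>

lemma diag_pencil_shift: "diag_pencil (\<lambda>i. t i + s) = diag_pencil t"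
proof -
  have "\<exists>a' b'. (\<lambda>i. a + b * (t i + s)) = (\<lambda>i. a' + b' * t i)" for a b
    by (rule exI[of _ "a + b * s"], rule exI[of _ b]) (simp add: algebra_simps)
  moreover have "\<exists>a' b'. (\<lambda>i. a + b * t i) = (\<lambda>i. a' + b' * (t i + s))" for a b
    by (rule exI[of _ "a - b * s"], rule exI[of _ b]) (simp add: algebra_simps)
  ultimately show ?thesis
    unfolding diag_pencil_eq diagm_eq_iff by (auto simp: diagm_eq_iff)
qed

lemma is_pencil_span_pair:
  assumes "A \<in> quadratic_forms" "B \<in> quadratic_forms"
    and indep: "\<And>a b. mscale a A + mscale b B = 0 \<Longrightarrow> a = 0 \<and> b = 0"
  shows "is_pencil (mat.span {A, B})"
proof -
  have q: "mscale c A + mscale d B \<in> quadratic_forms" for c d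
    using assms(1,2) by (simp add: quadratic_forms_def mscale_def transpose_def vec_eq_iff)
  moreover have B: "B \<noteq> 0" using indep[of 0 1] by auto
  moreover have "A \<notin> mat.span {B}"
  proof
    assume "A \<in> mat.span {B}"
    then obtain c where "A = mscale c B" by (auto simp: mat_span_singleton)
    then have "mscale 1 A + mscale (- c) B = 0" by simp
    from indep[OF this] show False by simp
  qed
  ultimately have "mat.independent {A, B}" "A \<noteq> B"
    by (auto simp: mat.independent_insert mat.span_base)
  then have "mat.dim (mat.span {A, B}) = 2"
    by (simp add: mat.dim_eq_card_independent)
  then show ?thesis
    using q by (auto simp: is_pencil_def mat.subspace_span) (auto simp: mat_span_pair)
qed

lemma pencil_basis:
  assumes "is_pencil \<Phi>"
  obtains A B where "\<Phi> = mat.span {A, B}"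
    "\<And>a b. mscale a A + mscale b B = 0 \<Longrightarrow> a = 0 \<and> b = 0"
proof -
  from assms obtain Z where Z: "Z \<subseteq> \<Phi>" "mat.independent Z" "\<Phi> \<subseteq> mat.span Z" "card Z = 2"
    using mat.basis_exists[of \<Phi>] unfolding is_pencil_def by metis
  then obtain A B where AB: "Z = {A, B}" "A \<noteq> B" by (auto simp: card_2_iff)
  have "mat.span Z \<subseteq> \<Phi>" using Z(1) assms by (simp add: is_pencil_def mat.span_minimal)
  moreover have "a = 0 \<and> b = 0" if 0: "mscale a A + mscale b B = 0" for a b
  proof (rule ccontr)
    assume ab: "\<not> (a = 0 \<and> b = 0)"
    have "\<exists>u. (\<exists>v\<in>{A, B}. u v \<noteq> 0) \<and> (\<Sum>v\<in>{A,B}. mscale (u v) v) = 0"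
      by (rule exI[of _ "\<lambda>v. if v = A then a else b"]) (use 0 AB(2) ab in auto)
    with Z(2) AB(1) show False by (subst (asm) mat.dependent_finite) auto
  qed
  ultimately show thesis using that[of A B] Z(3) AB(1) by blast
qed

text \<open>Nonsingularity is a property of the orbit: pulling back by an invertible matrix is an injective
  linear map on forms which preserves degeneracy, so it matches up the degenerate points of the two
  pencils.\<close>

lemma nonsingular_pencil_pullback:
  fixes \<Phi> :: "(complex^'k^'k) set" and T :: "complex^'k^'k"
  assumes \<Phi>: "nonsingular_pencil \<Phi>" and T: "invertible T"
  shows "nonsingular_pencil (pullback T ` \<Phi>)"
proof -
  have p: "is_pencil \<Phi>" using \<Phi> by (simp add: nonsingular_pencil_def)
  then obtain A B where AB: "\<Phi> = mat.span {A, B}"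
    "\<And>a b. mscale a A + mscale b B = 0 \<Longrightarrow> a = 0 \<and> b = 0"
    using pencil_basis[OF p] by blast
  have q: "A \<in> quadratic_forms" "B \<in> quadratic_forms"
    using p AB(1) mat.span_base[of _ "{A, B}"] by (auto simp: is_pencil_def)
  note inj = inj_pullback[OF T]
  have "is_pencil (mat.span {pullback T A, pullback T B})"
  proof (rule is_pencil_span_pair)
    fix a b assume "mscale a (pullback T A) + mscale b (pullback T B) = 0"
    then have "pullback T (mscale a A + mscale b B) = pullback T 0"
      by (simp add: pullback_add pullback_mscale)
    then show "a = 0 \<and> b = 0" by (intro AB(2)) (rule injD[OF inj])
  qed (auto intro: q pullback_quadratic_form)
  then have "is_pencil (pullback T ` \<Phi>)" by (simp add: AB pullback_span_pair)
  moreover have deg: "degenerate (pullback T C) \<longleftrightarrow> degenerate C" for C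
  proof -
    obtain T' where T': "T ** T' = mat 1" "T' ** T = mat 1" using T by (auto simp: invertible_def)
    have zero: "S *v v = 0 \<longleftrightarrow> v = 0" if "S' ** S = mat 1" for S S' :: "complex^'k^'k" and v
      by (metis that matrix_vector_mul_assoc matrix_vector_mul_lid matrix_vector_mult_0_right)
    have tr: "transpose T' ** transpose T = mat 1"
      using T'(1) by (metis matrix_transpose_mul transpose_mat)
    have ker: "pullback T C *v v = 0 \<longleftrightarrow> C *v (T *v v) = 0" for v
      unfolding pullback_def by (simp add: matrix_vector_mul_assoc[symmetric] zero[OF tr] del: transpose_matrix_vector)
    show ?thesis unfolding degenerate_iff ker
      by (metis T' matrix_vector_mul_assoc matrix_vector_mul_lid matrix_vector_mult_0_right)
  qed
  moreover have "degenerate_points (pullback T ` \<Phi>) = image (pullback T) ` degenerate_points \<Phi>"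
  proof -
    have nz: "pullback T C = 0 \<longleftrightarrow> C = 0" for C using inj by (metis injD pullback_zero)
    show ?thesis unfolding degenerate_points_def
      by (auto simp: deg nz image_iff pullback_span_singleton[symmetric]) (metis deg nz pullback_span_singleton)+
  qed
  moreover have "inj_on (image (pullback T)) Z" for Z
    using inj by (metis inj_image_eq_iff inj_onI)
  ultimately show ?thesis
    using \<Phi> by (simp add: nonsingular_pencil_def card_image)
qed

lemma pencil_class_pullback:
  fixes \<Phi> :: "(complex^'b^'b) set" and T :: "complex^'b^'b"
  assumes T: "invertible T"
  shows "pencil_class (pullback T ` \<Phi>) = pencil_class \<Phi>"
proof -
  have *: "pencil_class (pullback T ` \<Phi>) \<subseteq> pencil_class \<Phi>" if T: "invertible T" for T :: "complex^'b^'b" and \<Phi>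
    unfolding pencil_class_def image_image pullback_mult[symmetric]
    using T by (auto intro: invertible_mult)
  obtain T' where T': "T ** T' = mat 1" "T' ** T = mat 1" using T by (auto simp: invertible_def)
  then have "invertible T'" by (auto simp: invertible_def)
  moreover have "pullback T' ` pullback T ` \<Phi> = \<Phi>"
    unfolding image_image pullback_mult[symmetric] T' by simp
  ultimately show ?thesis using *[of T \<Phi>] *[of T' "pullback T ` \<Phi>"] T by auto
qed

section \<open>Interpolation of polynomials\<close>

definition nodal :: "'k set \<Rightarrow> ('k \<Rightarrow> complex) \<Rightarrow> complex poly" where
  "nodal A t = (\<Prod>k\<in>A. [:- t k, 1:])"

lemma poly_nodal: "poly (nodal A t) z = (\<Prod>k\<in>A. z - t k)"
  by (simp add: nodal_def poly_prod)

lemma nodal_nonzero [simp]: "nodal (A :: 'k::finite set) t \<noteq> 0"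
  by (simp add: nodal_def)

lemma degree_nodal [simp]: "degree (nodal (A :: 'k::finite set) t) = card A"
  by (simp add: nodal_def degree_prod_eq_sum_degree)

lemma lead_coeff_nodal: "lead_coeff (nodal A t) = 1"
  by (simp add: nodal_def lead_coeff_prod)

lemma coeff_nodal_card: "coeff (nodal (A :: 'k::finite set) t) (card A) = 1"
  using lead_coeff_nodal[of A t] by simp

lemma poly_nodal_zero_iff: "poly (nodal (A :: 'k::finite set) t) z = 0 \<longleftrightarrow> (\<exists>k\<in>A. z = t k)"
  by (auto simp: poly_nodal)

text \<open>The denominators \<open>\<Prod>\<^bsub>j \<noteq> k\<^esub> (t k - t j)\<close> of Lagrange interpolation, that is, the values at the nodes of
  the derivative of the nodal polynomial.\<close>

definition weight :: "('k::finite \<Rightarrow> complex) \<Rightarrow> 'k \<Rightarrow> complex" where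
  "weight t k = poly (nodal (- {k}) t) (t k)"

lemma weight_nonzero: "inj t \<Longrightarrow> weight t k \<noteq> 0"
  by (auto simp: weight_def poly_nodal_zero_iff dest: injD)

lemma poly_eq_if_eq_at_nodes:
  assumes "inj (t :: 'k::finite \<Rightarrow> complex)" "degree p < CARD('k)" "degree q < CARD('k)"
    and "\<And>k. poly p (t k) = poly q (t k)"
  shows "p = q"
proof (rule poly_eqI_degree[of "range t"])
  show "degree p < card (range t)" "degree q < card (range t)"
    using assms by (simp_all add: card_image)
qed (use assms(4) in auto)

definition interp :: "('k::finite \<Rightarrow> complex) \<Rightarrow> ('k \<Rightarrow> complex) \<Rightarrow> complex poly" where
  "interp t z = (\<Sum>k\<in>UNIV. smult (z k) (nodal (- {k}) t))"

lemma poly_interp: "poly (interp t z) x = (\<Sum>k\<in>UNIV. z k * poly (nodal (- {k}) t) x)"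
  by (simp add: interp_def poly_sum)

lemma poly_interp_node: "poly (interp t z) (t k) = z k * weight t k"
proof -
  have "poly (interp t z) (t k) = (\<Sum>j\<in>UNIV. if j = k then z k * weight t k else 0)"
    unfolding poly_interp
    by (intro sum.cong) (auto simp: weight_def poly_nodal_zero_iff)
  then show ?thesis by simp
qed

lemma degree_interp: "degree (interp t z :: complex poly) < CARD('k)"
  for t :: "'k::finite \<Rightarrow> complex"
proof -
  have "degree (interp t z) \<le> CARD('k) - 1"
    unfolding interp_def
    by (intro degree_sum_le) (auto intro!: order.trans[OF degree_smult_le] simp: Compl_eq_Diff_UNIV)
  moreover have "0 < CARD('k)" by (rule zero_less_card_finite)
  ultimately show ?thesis by linarith
qed

lemma interp_eqI:
  assumes "inj (t :: 'k::finite \<Rightarrow> complex)" "degree f < CARD('k)"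
    and "\<And>k. poly f (t k) = z k * weight t k"
  shows "interp t z = f"
  by (rule poly_eq_if_eq_at_nodes[OF assms(1) degree_interp assms(2)]) (simp add: assms(3) poly_interp_node)

lemma lagrange:
  assumes "inj (t :: 'k::finite \<Rightarrow> complex)" "degree f < CARD('k)"
  shows "interp t (\<lambda>k. poly f (t k) / weight t k) = f"
  by (rule interp_eqI[OF assms]) (simp add: weight_nonzero assms)

text \<open>Comparison of the top coefficients in Lagrange's formula. In particular the sum vanishes if the degree
  of \<open>f\<close> is at most the number of nodes minus 2; the orthogonality relations below rest on this.\<close>

lemma divided_difference:
  assumes "inj (t :: 'k::finite \<Rightarrow> complex)" "degree f < CARD('k)"
  shows "(\<Sum>k\<in>UNIV. poly f (t k) / weight t k) = coeff f (CARD('k) - 1)"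
proof -
  have "coeff f (CARD('k) - 1) = coeff (interp t (\<lambda>k. poly f (t k) / weight t k)) (CARD('k) - 1)"
    by (simp add: lagrange[OF assms])
  also have "\<dots> = (\<Sum>k\<in>UNIV. poly f (t k) / weight t k)"
    unfolding interp_def coeff_sum coeff_smult
    using coeff_nodal_card[of "- {k}" t for k] by (simp add: Compl_eq_Diff_UNIV)
  finally show ?thesis by simp
qed

text \<open>The two equations of an intersection of two diagonal quadrics, in terms of the interpolating
  polynomial: each of them lowers the degree by one. The second one is the vanishing of the same top
  coefficient as in the first, for the polynomial multiplied by the variable.\<close>

lemma degree_interp_cone:
  fixes t z :: "'m::finite \<Rightarrow> complex"
  assumes "inj t" "2 < CARD('m)"
    and "(\<Sum>k\<in>UNIV. z k) = 0" "(\<Sum>k\<in>UNIV. t k * z k) = 0"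
  shows "degree (interp t z) \<le> CARD('m) - 3"
proof -
  let ?P = "interp t z"
  have less: "degree f < CARD('m) - 1" if "degree f < CARD('m)" "coeff f (CARD('m) - 1) = 0"
    for f :: "complex poly"
  proof (cases "f = 0")
    case False
    then have "degree f \<noteq> CARD('m) - 1" using that(2) leading_coeff_0_iff by metis
    with that(1) show ?thesis by linarith
  qed (use assms(2) in simp)
  have "coeff ?P (CARD('m) - 1) = 0"
    using divided_difference[OF assms(1) degree_interp[of t z]] assms(1,3)
    by (simp add: poly_interp_node weight_nonzero)
  then have d1: "degree ?P < CARD('m) - 1" by (intro less degree_interp)
  have "degree ([:0,1:] * ?P) < CARD('m)"
    using d1 degree_mult_le[of "[:0,1:]" ?P] by simp
  from divided_difference[OF assms(1) this]
  have "coeff ([:0,1:] * ?P) (CARD('m) - 1) = 0" 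
    using assms(1,4) by (simp add: poly_interp_node weight_nonzero)
  with less[OF \<open>degree ([:0,1:] * ?P) < CARD('m)\<close>]
  have "degree ([:0,1:] * ?P) < CARD('m) - 1" by simp
  then show ?thesis by (cases "?P = 0") (simp_all add: degree_pCons_eq)
qed

lemma poly_eq_smult_nodal:
  fixes t :: "'k::finite \<Rightarrow> complex"
  assumes "inj t" "degree p = CARD('k)" "\<And>k. poly p (t k) = 0"
  shows "p = smult (lead_coeff p) (nodal UNIV t)"
proof (rule poly_eqI_degree_lead_coeff[where n = "CARD('k)" and A = "range t"])
  show "coeff p (CARD('k)) = coeff (smult (lead_coeff p) (nodal UNIV t)) (CARD('k))"
    using coeff_nodal_card[of UNIV t] assms(2) by simp
qed (use assms in \<open>auto simp: card_image poly_nodal_zero_iff\<close>)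

text \<open>The absolute value of \<open>p\<close> at \<open>w\<close> is that of the leading coefficient times the product of the distances
  from \<open>w\<close> to the roots, so the distances cannot all be at least \<open>\<epsilon>\<close>.\<close>

lemma nearby_root:
  fixes p :: "complex poly"
  assumes "0 < \<epsilon>" "0 < degree p" "cmod (poly p w) < \<epsilon> ^ degree p * cmod (lead_coeff p)"
  shows "\<exists>z. poly p z = 0 \<and> cmod (w - z) < \<epsilon>"
proof (rule ccontr)
  assume *: "\<not> ?thesis"
  obtain r where r: "smult (lead_coeff p) (\<Prod>i<degree p. [:- r i, 1:]) = p"
    by (rule complex_poly_decompose')
  have val: "poly p u = lead_coeff p * (\<Prod>i<degree p. u - r i)" for u
    by (subst r[symmetric]) (simp add: poly_prod)
  have "poly p (r i) = 0" if "i < degree p" for i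
    unfolding val using that by auto
  with * have "\<epsilon> \<le> cmod (w - r i)" if "i < degree p" for i
    using that by (meson not_le)
  then have "(\<Prod>i<degree p. \<epsilon>) \<le> (\<Prod>i<degree p. cmod (w - r i))"
    using assms(1) by (intro prod_mono) auto
  then have "\<epsilon> ^ degree p * cmod (lead_coeff p) \<le> cmod (poly p w)"
    unfolding val[of w] norm_mult prod_norm[symmetric] by (simp add: mult.commute[of _ "cmod (lead_coeff p)"] mult_left_mono)
  with assms(3) show False by simp
qed

text \<open>A condition that is visibly open, and forces a polynomial of degree at most \<open>n\<close> to have simple roots
  close to the \<open>n\<close> points \<open>\<tau>\<close> when these are \<open>2\<epsilon>\<close> apart from each other. It takes the place of the nonvanishing of the discriminant.\<close>

definition near_simple_roots :: "real \<Rightarrow> ('k::finite \<Rightarrow> complex) \<Rightarrow> complex poly \<Rightarrow> bool" where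
  "near_simple_roots \<epsilon> \<tau> p \<longleftrightarrow> coeff p (CARD('k)) \<noteq> 0 \<and>
     (\<forall>k. cmod (poly p (\<tau> k)) < \<epsilon> ^ CARD('k) * cmod (coeff p (CARD('k))))"

lemma near_simple_roots_imp:
  fixes \<tau> :: "'k::finite \<Rightarrow> complex"
  assumes p: "near_simple_roots \<epsilon> \<tau> p" "degree p \<le> CARD('k)"
    and \<epsilon>: "0 < \<epsilon>" "\<And>i j. i \<noteq> j \<Longrightarrow> 2 * \<epsilon> \<le> cmod (\<tau> i - \<tau> j)"
  obtains t :: "'k \<Rightarrow> complex" and c where "inj t" "c \<noteq> 0" "p = smult c (nodal UNIV t)"
proof -
  have deg: "degree p = CARD('k)" using p by (auto simp: near_simple_roots_def intro: antisym le_degree)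
  have "\<exists>z. poly p z = 0 \<and> cmod (\<tau> k - z) < \<epsilon>" for k
    using p(1) deg by (intro nearby_root \<epsilon>) (auto simp: near_simple_roots_def)
  then have "\<exists>t. \<forall>k. poly p (t k) = 0 \<and> cmod (\<tau> k - t k) < \<epsilon>" by (intro choice allI)
  then obtain t where t: "\<And>k. poly p (t k) = 0" "\<And>k. cmod (\<tau> k - t k) < \<epsilon>" by blast
  have "inj t"
  proof (rule injI, rule ccontr)
    fix i j assume *: "t i = t j" "i \<noteq> j"
    have "cmod (\<tau> i - \<tau> j) \<le> cmod (\<tau> i - t i) + cmod (\<tau> j - t j)"
      using *(1) norm_triangle_ineq4[of "\<tau> i - t i" "\<tau> j - t j"] by simp
    also have "\<dots> < 2 * \<epsilon>" using t(2)[of i] t(2)[of j] by simp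
    finally show False using \<epsilon>(2)[OF *(2)] by simp
  qed
  moreover have "lead_coeff p \<noteq> 0" using p deg by (auto simp: near_simple_roots_def)
  ultimately show thesis using that[of t "lead_coeff p"] poly_eq_smult_nodal[OF \<open>inj t\<close> deg t(1)] by simp
qed

section \<open>Simultaneous diagonalization\<close>

lemma inj_matrix_iff: "inj ((*v) (M :: complex^'n^'m)) \<longleftrightarrow> (\<forall>v. M *v v = 0 \<longrightarrow> v = 0)"
proof
  assume "\<forall>v. M *v v = 0 \<longrightarrow> v = 0"
  then show "inj ((*v) M)"
    by (intro injI) (metis matrix_vector_mult_diff_distrib right_minus_eq)
qed (metis injD matrix_vector_mult_0_right)

lemma dependent_if_card_gt: "CARD('n) < card S \<Longrightarrow> vec.dependent (S :: (complex^'n) set)"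
  using vec.independent_card_le_dim[of S UNIV] by (metis vec_dim_card leD subset_UNIV)

lemma matrix_vector_mult_sum: "M *v (\<Sum>i\<in>I. v i) = (\<Sum>i\<in>I. M *v v i)"
  by (induction I rule: infinite_finite_induct) (auto simp: matrix_vector_right_distrib)

text \<open>The value of the polynomial \<open>p(T)\<close> at the vector \<open>u\<close>, by Horner's rule.\<close>

definition poly_vec :: "complex^'n^'n \<Rightarrow> complex poly \<Rightarrow> complex^'n \<Rightarrow> complex^'n" where
  "poly_vec T p u = fold_coeffs (\<lambda>a v. a *s u + T *v v) p 0"

lemma poly_vec_0 [simp]: "poly_vec T 0 u = 0"
  by (simp add: poly_vec_def)

lemma poly_vec_pCons [simp]: "poly_vec T (pCons a p) u = a *s u + T *v poly_vec T p u"
  by (cases "a = 0 \<and> p = 0") (auto simp: poly_vec_def)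

lemma poly_vec_add: "poly_vec T (p + q) u = poly_vec T p u + poly_vec T q u"
  by (induction p q rule: poly_induct2) (auto simp: matrix_vector_right_distrib algebra_simps)

lemma poly_vec_smult: "poly_vec T (smult c p) u = c *s poly_vec T p u"
  by (induction p) (auto simp: vector_scalar_commute vector_add_ldistrib vector_smult_assoc)

lemma poly_vec_linear_factor:
  "poly_vec T ([:- r, 1:] * q) u = T *v poly_vec T q u - r *s poly_vec T q u"
proof -
  have "[:- r, 1:] * q = pCons 0 q + smult (- r) q" by simp
  then show ?thesis by (simp only: poly_vec_add poly_vec_smult poly_vec_pCons) simp
qed

lemma poly_vec_monom: "poly_vec T (monom c n) u = c *s (((*v) T) ^^ n) u"
  by (induction n) (auto simp: monom_0 monom_Suc vector_scalar_commute)

lemma poly_vec_sum: "poly_vec T (\<Sum>i\<in>I. p i) u = (\<Sum>i\<in>I. poly_vec T (p i) u)"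
  by (induction I rule: infinite_finite_induct) (auto simp: poly_vec_add)

lemma poly_vec_mem:
  assumes "vec.subspace U" "\<And>v. v \<in> U \<Longrightarrow> T *v v \<in> U" "u \<in> U"
  shows "poly_vec T p u \<in> U"
  using assms by (induction p) (auto intro: vec.subspace_add vec.subspace_scale vec.subspace_0)

lemma annihilating_polynomial:
  fixes T :: "complex^'n^'n"
  obtains p where "p \<noteq> 0" "poly_vec T p u = 0"
proof -
  let ?f = "\<lambda>i. (((*v) T) ^^ i) u"
  show thesis
  proof (cases "inj_on ?f {..CARD('n)}")
    case False
    then obtain i j where "i \<noteq> j" "?f i = ?f j" by (auto simp: inj_on_def)
    then have "poly_vec T (monom 1 i + smult (- 1) (monom 1 j)) u = 0"
      unfolding poly_vec_add poly_vec_smult poly_vec_monom by simp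
    moreover have "coeff (monom 1 i + smult (- 1) (monom 1 j)) i \<noteq> (0 :: complex)"
      using \<open>i \<noteq> j\<close> by simp
    ultimately show thesis using that by (metis coeff_0)
  next
    case True
    then have "card (?f ` {..CARD('n)}) = CARD('n) + 1" by (simp add: card_image)
    then have "vec.dependent (?f ` {..CARD('n)})"
      by (intro dependent_if_card_gt) simp
    then obtain c where c: "\<exists>v\<in>?f ` {..CARD('n)}. c v \<noteq> 0" "(\<Sum>v\<in>?f ` {..CARD('n)}. c v *s v) = 0"
      by (subst (asm) vec.dependent_finite) auto
    define p where "p = (\<Sum>i\<le>CARD('n). monom (c (?f i)) i)"
    have "poly_vec T p u = 0"
      using c(2) by (simp add: p_def poly_vec_sum poly_vec_monom sum.reindex[OF True])
    moreover obtain i where i: "i \<le> CARD('n)" "c (?f i) \<noteq> 0" using c(1) by auto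
    have "coeff p i = (\<Sum>j\<le>CARD('n). if j = i then c (?f i) else 0)"
      unfolding p_def coeff_sum by (intro sum.cong) auto
    then have "coeff p i \<noteq> 0" using i by simp
    then have "p \<noteq> 0" by auto
    ultimately show thesis using that by blast
  qed
qed

text \<open>The Krylov argument. Some nonzero polynomial in \<open>T\<close> kills \<open>u\<close>; if one splits off its roots one
  at a time, the last factor \<open>T - r\<close> that produces the zero vector exhibits an eigenvector, and all
  vectors that occur stay in the invariant subspace.\<close>

lemma eigenvector_in_invariant_subspace:
  fixes T :: "complex^'n^'n"
  assumes U: "vec.subspace U" "\<And>v. v \<in> U \<Longrightarrow> T *v v \<in> U" and u: "u \<in> U" "u \<noteq> 0"
  obtains v \<mu> where "v \<in> U" "v \<noteq> 0" "T *v v = \<mu> *s v"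
proof -
  have "\<exists>v \<mu>. v \<in> U \<and> v \<noteq> 0 \<and> T *v v = \<mu> *s v" if "p \<noteq> 0" "poly_vec T p u = 0" for p
    using that
  proof (induction "degree p" arbitrary: p rule: less_induct)
    case less
    have "degree p \<noteq> 0"
    proof
      assume "degree p = 0"
      then obtain a where "p = [:a:]" by (metis degree_eq_zeroE)
      with less.prems u(2) show False by simp
    qed
    then obtain r where "poly p r = 0"
      using fundamental_theorem_of_algebra constant_degree by metis
    then obtain q where q: "p = [:- r, 1:] * q" by (auto simp: poly_eq_0_iff_dvd dvd_def)
    then have "q \<noteq> 0" using less.prems(1) by auto
    then have deg: "degree q < degree p" using q by (simp add: degree_mult_eq del: mult_pCons_left)
    show ?case
    proof (cases "poly_vec T q u = 0")
      case True
      then show ?thesis using less.hyps deg \<open>q \<noteq> 0\<close> by blast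
    next
      case False
      moreover have "T *v poly_vec T q u = r *s poly_vec T q u"
        using less.prems(2) unfolding q poly_vec_linear_factor by simp
      ultimately show ?thesis using poly_vec_mem[OF U u(1)] by blast
    qed
  qed
  then show thesis using that annihilating_polynomial by metis
qed

text \<open>Simultaneous diagonalization by the spectral argument for the operator \<open>A\<^sup>-\<^sup>1B\<close>, which is
  self-adjoint for \<open>A\<close>. Over the complex numbers an eigenvector may be isotropic for \<open>A\<close>, and then its
  orthogonal complement contains it; the hypothesis \<open>aniso\<close> excludes exactly this.\<close>

lemma orthonormal_eigenbasis:
  fixes A B :: "complex^'m^'m"
  assumes q: "A \<in> quadratic_forms" "B \<in> quadratic_forms"
    and A: "invertible A"
    and aniso: "\<And>v \<mu>. v \<noteq> 0 \<Longrightarrow> B *v v = \<mu> *s (A *v v) \<Longrightarrow> bil A v v \<noteq> 0"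
  shows "\<exists>(w :: 'm \<Rightarrow> complex^'m) \<mu>. (\<forall>i j. bil A (w i) (w j) = (if i = j then 1 else 0)) \<and>
    (\<forall>i. B *v w i = \<mu> i *s (A *v w i))"
proof -
  obtain A' where A': "A ** A' = mat 1" "A' ** A = mat 1" using A by (auto simp: invertible_def)
  have "\<exists>w \<mu>. (\<forall>i\<in>I. \<forall>j\<in>I. bil A (w i) (w j) = (if i = j then 1 else 0)) \<and>
          (\<forall>i\<in>I. B *v w i = \<mu> i *s (A *v w i))" for I :: "'m set"
  proof (induction I rule: finite_induct[OF finite])
    case (2 j I)
    then obtain w \<mu> where w: "\<And>i k. i \<in> I \<Longrightarrow> k \<in> I \<Longrightarrow> bil A (w i) (w k) = (if i = k then 1 else 0)"
      "\<And>i. i \<in> I \<Longrightarrow> B *v w i = \<mu> i *s (A *v w i)" by blast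
    define U where "U = {u. \<forall>i\<in>I. bil A u (w i) = 0}"
    have U: "vec.subspace U"
      by (rule vec.subspaceI) (auto simp: U_def bil_add_left bil_scale_left)
    have inv: "(A' ** B) *v u \<in> U" if "u \<in> U" for u
      unfolding U_def
    proof (intro CollectI ballI)
      fix i assume i: "i \<in> I"
      have "bil A ((A' ** B) *v u) (w i) = bil A (w i) ((A' ** B) *v u)" by (rule bil_sym[OF q(1)])
      also have "\<dots> = bil B (w i) u"
        by (simp add: bil_eq_sum matrix_vector_mul_assoc[symmetric]) (simp add: matrix_vector_mul_assoc A' matrix_mul_assoc)
      also have "\<dots> = bil B u (w i)" by (rule bil_sym[OF q(2)])
      also have "\<dots> = \<mu> i * bil A u (w i)"
        by (rule bil_eigenvector[OF w(2)[OF i]])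
      finally show "bil A ((A' ** B) *v u) (w i) = 0" using that i by (simp add: U_def)
    qed
    obtain u where u: "u \<in> U" "u \<noteq> 0"
    proof -
      \<comment> \<open>The complement is nonzero: it is the kernel of a square matrix whose row \<open>j\<close> vanishes.\<close>
      define M :: "complex^'m^'m" where "M = (\<chi> i. if i \<in> I then A *v w i else 0)"
      have M: "(M *v u) $ i = (if i \<in> I then bil A u (w i) else 0)" for u i
        by (auto simp: M_def matrix_vector_mult_def bil_eq_sum mult.commute)
      have "\<not> surj ((*v) M)"
      proof
        assume "surj ((*v) M)"
        then obtain u where "M *v u = axis j 1" by (metis surjD)
        then show False using M[of u j] 2(2) by (simp add: axis_def)
      qed
      then have "\<not> inj ((*v) M)"
        by (metis matrix_left_invertible_injective matrix_left_right_inverse matrix_right_invertible_surjective)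
      then obtain u where u: "u \<noteq> 0" "M *v u = 0"
        by (auto simp: inj_matrix_iff)
      have "bil A u (w i) = 0" if "i \<in> I" for i
        using M[of u i] u(2) that by simp
      then show thesis using that[of u] u(1) by (simp add: U_def)
    qed
    obtain v \<nu> where v: "v \<in> U" "v \<noteq> 0" "(A' ** B) *v v = \<nu> *s v"
      using eigenvector_in_invariant_subspace[OF U inv u] by blast
    have Bv: "B *v v = \<nu> *s (A *v v)"
    proof -
      have "B *v v = A *v ((A' ** B) *v v)" by (simp add: matrix_vector_mul_assoc matrix_mul_assoc A')
      then show ?thesis by (simp add: v(3) vector_scalar_commute)
    qed
    define s where "s = csqrt (bil A v v)"
    have s: "s * s = bil A v v" "s \<noteq> 0"
      using aniso[OF v(2) Bv] by (auto simp: s_def simp flip: power2_eq_square)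
    define w' where "w' = w(j := (1 / s) *s v)"
    have "bil A (w' i) (w' k) = (if i = k then 1 else 0)" if "i \<in> insert j I" "k \<in> insert j I" for i k
    proof -
      have vI: "bil A v (w i) = 0" "bil A (w i) v = 0" if "i \<in> I" for i
        using v(1) that bil_sym[OF q(1)] by (auto simp: U_def)
      have "bil A ((1 / s) *s v) ((1 / s) *s v) = 1"
        using s(2) by (simp add: bil_scale_left bil_scale_right flip: s(1))
      then show ?thesis using that 2(2) w(1) vI by (auto simp: w'_def bil_scale_left bil_scale_right)
    qed
    moreover have "B *v w' i = (\<mu>(j := \<nu>)) i *s (A *v w' i)" if "i \<in> insert j I" for i
      using that w(2) Bv 2(2) by (auto simp: w'_def vector_scalar_commute vector_smult_assoc mult.commute)
    ultimately show ?case by blast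
  qed auto
  from this[of UNIV] show ?thesis by simp
qed

lemma pullback_eigenbasis:
  assumes "\<And>i j. bil A (w i) (w j) = (if i = j then 1 else 0)"
    "\<And>i. B *v w i = \<mu> i *s (A *v w i)"
  shows "pullback (cols w) A = diagm (\<lambda>_. 1)" "pullback (cols w) B = diagm \<mu>"
proof -
  have "bil B (w i) (w j) = \<mu> j * bil A (w i) (w j)" for i j
    by (rule bil_eigenvector[OF assms(2)])
  then show "pullback (cols w) A = diagm (\<lambda>_. 1)" "pullback (cols w) B = diagm \<mu>"
    by (auto intro!: pullback_cols_orthogonal simp: assms(1))
qed

text \<open>Let \<open>v \<noteq> 0\<close> be in the kernel of a member of the pencil. That member vanishes at \<open>v\<close> and has zero
  gradient there, so by the Jacobian criterion the pencil cannot vanish at \<open>v\<close> as a whole. This single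
  remark gives everything: the general member is nondegenerate, eigenvectors are not isotropic, and the
  eigenvalues are distinct.\<close>

lemma jacobian_normal_form:
  fixes A B :: "complex^'m^'m"
  assumes q: "A \<in> quadratic_forms" "B \<in> quadratic_forms"
    and jac: "\<And>v s t. v \<noteq> 0 \<Longrightarrow> bil A v v = 0 \<Longrightarrow> bil B v v = 0 \<Longrightarrow>
       s *s (A *v v) + t *s (B *v v) = 0 \<Longrightarrow> s = 0 \<and> t = 0"
  shows "\<exists>(S :: complex^'m^'m) \<mu>. invertible S \<and> inj \<mu> \<and> pullback S ` mat.span {A, B} = diag_pencil \<mu>"
proof -
  have mv: "(A + mscale t B) *v v = A *v v + t *s (B *v v)" for t v
    by (simp add: matrix_vector_mult_add_rdistrib matrix_vector_mult_mscale)
  \<comment> \<open>Otherwise every \<open>A + t B\<close> has a kernel vector \<open>v t\<close>. For distinct parameters these are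
    \<open>B\<close>-orthogonal, and none is \<open>B\<close>-isotropic, so there are too many independent ones.\<close>
  obtain t0 where t0: "\<not> degenerate (A + mscale t0 B)"
  proof (rule ccontr)
    assume "\<not> thesis"
    with that have "\<forall>t. \<exists>v. v \<noteq> 0 \<and> (A + mscale t B) *v v = 0" unfolding degenerate_iff by blast
    then obtain v where v: "\<And>t. v t \<noteq> 0" "\<And>t. A *v v t + t *s (B *v v t) = 0" unfolding mv by metis
    have ABv: "bil A u (v t) = - t * bil B u (v t)" for u t
      using v(2)[of t] by (intro bil_eigenvector) (simp add: add_eq_0_iff)
    have B0: "bil B (v t) (v t) \<noteq> 0" for t
      using jac[OF v(1), of t 1 t] v(2)[of t] ABv[of "v t" t] by auto
    have orth: "bil B (v s) (v t) = 0" if "s \<noteq> t" for s t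
    proof -
      have "- t * bil B (v s) (v t) = - s * bil B (v s) (v t)"
        using ABv[of "v s" t] ABv[of "v t" s] bil_sym[OF q(1)] bil_sym[OF q(2)] by metis
      then show ?thesis using that by auto
    qed
    define T :: "complex set" where "T = of_nat ` {..CARD('m)}"
    have inj: "inj v" 
      by (rule injI) (metis B0 orth)
    have "card T = CARD('m) + 1"
      unfolding T_def by (simp add: card_image inj_on_def)
    then have "card (v ` T) = CARD('m) + 1"
      using inj card_image[of v T] by (simp add: inj_on_subset)
    then have "vec.dependent (v ` T)"
      by (intro dependent_if_card_gt) simp
    moreover have fin: "finite (v ` T)" by (simp add: T_def)
    ultimately obtain c where c: "\<exists>u\<in>v ` T. c u \<noteq> 0" "(\<Sum>u\<in>v ` T. c u *s u) = 0"
      by (subst (asm) vec.dependent_finite) auto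
    obtain t where t: "t \<in> T" "c (v t) \<noteq> 0" using c(1) by auto
    have "0 = bil B (\<Sum>u\<in>v ` T. c u *s u) (v t)" by (simp add: c(2))
    also have "\<dots> = (\<Sum>s\<in>T. c (v s) * bil B (v s) (v t))"
      by (simp add: bil_sum_left T_def bil_scale_left sum.reindex[OF inj_on_subset[OF inj subset_UNIV]])
    also have "\<dots> = (\<Sum>s\<in>T. if s = t then c (v t) * bil B (v t) (v t) else 0)"
      by (intro sum.cong) (auto simp: orth)
    also have "\<dots> = c (v t) * bil B (v t) (v t)" using t(1) by (simp add: T_def)
    finally show False using t(2) B0 by simp
  qed
  define C where "C = A + mscale t0 B"
  have Cmv: "C *v v = A *v v + t0 *s (B *v v)" for v unfolding C_def by (rule mv)
  have qC: "C \<in> quadratic_forms"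
    using q by (simp add: quadratic_forms_def mscale_def transpose_def vec_eq_iff C_def)
  have "inj ((*v) C)"
    using t0 unfolding degenerate_iff C_def[symmetric] inj_matrix_iff by blast
  then have invC: "invertible C" by (rule invertible_if_inj)
  have bC: "bil C v v = bil A v v + t0 * bil B v v" for v by (simp add: C_def bil_matrix_add bil_mscale)
  have aniso: "bil C v v \<noteq> 0" if v: "v \<noteq> 0" "B *v v = \<mu> *s (C *v v)" for v \<mu>
  proof
    assume C0: "bil C v v = 0"
    have "bil B v v = \<mu> * bil C v v" by (rule bil_eigenvector[OF v(2)])
    then have "bil B v v = 0" "bil A v v = 0" using C0 bC[of v] by auto
    moreover have "(- \<mu>) *s (A *v v) + (1 - \<mu> * t0) *s (B *v v) = 0"
      using v(2) unfolding Cmv by (simp add: vec_eq_iff algebra_simps)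
    ultimately have "- \<mu> = 0 \<and> 1 - \<mu> * t0 = 0" using jac[OF v(1)] by blast
    then show False by auto
  qed
  obtain w :: "'m \<Rightarrow> complex^'m" and \<mu> where w: "\<And>i j. bil C (w i) (w j) = (if i = j then 1 else 0)"
    "\<And>i. B *v w i = \<mu> i *s (C *v w i)"
    using orthonormal_eigenbasis[OF qC q(2) invC] aniso by blast
  note pb = pullback_eigenbasis[OF w]
  have "invertible (cols w)"
    using inj_if_pullback_one[of "cols w" C] pb(1) by (auto simp: diagm_one intro: invertible_if_inj)
  moreover have "inj \<mu>"
  proof (rule injI, rule ccontr)
    fix i j assume ij: "\<mu> i = \<mu> j" "i \<noteq> j"
    \<comment> \<open>In a two-dimensional eigenspace this combination would be an isotropic eigenvector.\<close>
    let ?v = "w i + \<i> *s w j"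
    have "bil C (w i) ?v = 1" using ij(2) by (simp add: bil_add_right bil_scale_right w(1))
    then have "?v \<noteq> 0" by (metis bil_zero_right zero_neq_one)
    moreover have "B *v ?v = \<mu> i *s (C *v ?v)"
      by (simp add: matrix_vector_right_distrib vector_scalar_commute w(2) ij(1) vec_eq_iff algebra_simps)
    ultimately have "bil C ?v ?v \<noteq> 0" by (rule aniso)
    then show False using ij(2) by (simp add: bil_add_left bil_add_right bil_scale_left bil_scale_right w(1))
  qed
  moreover have "mat.span {A, B} = mat.span {C, B}"
    unfolding C_def by (rule span_pair_shift[symmetric])
  ultimately show ?thesis
    by (intro exI[of _ "cols w"] exI[of _ \<mu>]) (simp add: pullback_span_pair pb diag_pencil_def)
qed


text \<open>A linear relation between the eigenvectors persists when its coefficients are multiplied by \<open>p(t k)\<close>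
  for any polynomial \<open>p\<close>; a \<open>p\<close> that vanishes at all eigenvalues except \<open>t k\<close> isolates the \<open>k\<close>-th term.\<close>

lemma eigenvectors_independent:
  fixes A B :: "complex^'k^'m"
  assumes A: "inj ((*v) A)" and t: "inj (t :: 'n::finite \<Rightarrow> complex)"
    and w: "\<And>k. B *v w k = t k *s (A *v w k)" "\<And>k. w k \<noteq> 0"
  shows "inj ((*v) (cols w))"
  unfolding inj_matrix_iff
proof (intro allI impI)
  fix u assume u: "cols w *v u = 0"
  have sum: "M *v (\<Sum>k\<in>UNIV. c k *s w k) = (\<Sum>k\<in>UNIV. c k *s (M *v w k))" for M :: "complex^'k^'m" and c
    by (simp add: matrix_vector_mult_sum vector_scalar_commute)
  have step: "(\<Sum>k\<in>UNIV. (t k * c k) *s w k) = 0" if "(\<Sum>k\<in>UNIV. c k *s w k) = 0" for c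
  proof -
    have "A *v (\<Sum>k\<in>UNIV. (t k * c k) *s w k) = B *v (\<Sum>k\<in>UNIV. c k *s w k)"
      unfolding sum w(1) by (simp add: vector_smult_assoc mult.commute)
    then show ?thesis using that A by (simp add: inj_matrix_iff)
  qed
  have *: "(\<Sum>k\<in>UNIV. (poly p (t k) * u $ k) *s w k) = 0" for p
  proof (induction p)
    case (pCons a p)
    have "(\<Sum>k\<in>UNIV. (poly (pCons a p) (t k) * u $ k) *s w k) =
       a *s (\<Sum>k\<in>UNIV. u $ k *s w k) + (\<Sum>k\<in>UNIV. (t k * (poly p (t k) * u $ k)) *s w k)"
      by (simp add: vec.scale_sum_right vector_smult_assoc algebra_simps sum.distrib)
    then show ?case using step[OF pCons(2)] u by (simp add: cols_mult)
  qed simp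
  have "u $ k = 0" for k
  proof -
    have "0 = (\<Sum>j\<in>UNIV. (poly (nodal (- {k}) t) (t j) * u $ j) *s w j)" by (simp only: *)
    also have "\<dots> = (\<Sum>j\<in>UNIV. if j = k then (weight t k * u $ k) *s w k else 0)"
      by (intro sum.cong) (auto simp: weight_def poly_nodal_zero_iff)
    also have "\<dots> = (weight t k * u $ k) *s w k" by simp
    finally show ?thesis using w(2)[of k] weight_nonzero[OF t] by (simp add: vec.scale_eq_0_iff)
  qed
  then show "u = 0" by (simp add: vec_eq_iff)
qed

lemma span_singleton_eqI:
  assumes "c \<noteq> 0" "D = mscale c C" shows "mat.span {D} = mat.span {C}"
proof -
  have 1: "mscale a D = mscale (a * c) C" for a using assms(2) by (simp add: mscale_def vec_eq_iff)
  have 2: "mscale a C = mscale (a / c) D" for a using assms by (simp add: mscale_def vec_eq_iff)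
  show ?thesis
    unfolding mat_span_singleton
  proof (intro equalityI subsetI)
    fix E assume "E \<in> {mscale a D | a. True}"
    then show "E \<in> {mscale a C | a. True}" using 1 by blast
  next
    fix E assume "E \<in> {mscale a C | a. True}"
    then show "E \<in> {mscale a D | a. True}" using 2 by blast
  qed
qed

text \<open>The classification of nonsingular pencils. With \<open>A\<close> a nondegenerate member and \<open>B\<close> another one, the
  degenerate points are the members \<open>B - \<mu> A\<close> with \<open>\<mu>\<close> an eigenvalue, so there are \<open>n\<close> distinct eigenvalues.
  Their eigenvectors are \<open>A\<close>-orthogonal for free and form a basis by a count, and since \<open>A\<close> is
  nondegenerate they can be normalized.\<close>

lemma nonsingular_pencil_normal_form:
  fixes \<Phi> :: "(complex^'n^'n) set"
  assumes \<Phi>: "nonsingular_pencil \<Phi>"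
  obtains S :: "complex^'n^'n" and t where "invertible S" "inj t" "pullback S ` \<Phi> = diag_pencil t"
proof -
  have p: "is_pencil \<Phi>" "finite (degenerate_points \<Phi>)" "card (degenerate_points \<Phi>) = CARD('n)"
    using \<Phi> by (auto simp: nonsingular_pencil_def)
  obtain A0 B where AB0: "\<Phi> = mat.span {A0, B}"
    "\<And>a b. mscale a A0 + mscale b B = 0 \<Longrightarrow> a = 0 \<and> b = 0"
    using pencil_basis[OF p(1)] by blast
  have comb: "mscale a A + mscale b B \<in> mat.span {A, B}" for a b A B
    by (auto simp: mat_span_pair)
  obtain t0 where t0: "\<not> degenerate (A0 + mscale t0 B)"
  proof (rule ccontr)
    assume *: "\<not> thesis"
    let ?f = "\<lambda>t. mat.span {A0 + mscale t B}"
    have "?f t \<in> degenerate_points \<Phi>" for t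
    proof -
      have "A0 + mscale t B \<in> \<Phi>" using comb[of 1 A0 t B] by (simp add: AB0(1))
      moreover have "A0 + mscale t B \<noteq> 0" using AB0(2)[of 1 t] by auto
      ultimately show ?thesis using * that unfolding degenerate_points_def by blast
    qed
    then have "finite (range ?f)" using p(2) by (meson finite_subset image_subsetI)
    moreover have "inj ?f"
    proof (rule injI)
      fix s t assume "?f s = ?f t"
      then have "A0 + mscale s B \<in> mat.span {A0 + mscale t B}" using mat.span_base by blast
      then obtain c where "A0 + mscale s B = mscale c (A0 + mscale t B)"
        by (auto simp: mat_span_singleton)
      then have "mscale (1 - c) A0 + mscale (s - c * t) B = 0"
        by (simp add: mscale_def vec_eq_iff algebra_simps)
      from AB0(2)[OF this] show "s = t" by simp
    qed
    ultimately show False using finite_imageD infinite_UNIV_char_0 by blast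
  qed
  define A where "A = A0 + mscale t0 B"
  have span: "\<Phi> = mat.span {A, B}"
    unfolding A_def span_pair_shift by (rule AB0(1))
  have indep: "a = 0 \<and> b = 0" if "mscale a A + mscale b B = 0" for a b
  proof -
    have "mscale a A0 + mscale (b + a * t0) B = mscale a A + mscale b B"
      by (simp add: A_def mscale_def vec_eq_iff algebra_simps)
    then show ?thesis using AB0(2)[of a "b + a * t0"] that by auto
  qed
  have ndA: "\<not> degenerate A" using t0 by (simp add: A_def)
  have q: "A \<in> quadratic_forms" "B \<in> quadratic_forms"
    using p(1) span mat.span_base[of _ "{A, B}"] by (auto simp: is_pencil_def)
  have injA: "inj ((*v) A)" using ndA by (auto simp: degenerate_iff inj_matrix_iff)
  define E where "E = {\<mu>. degenerate (B + mscale (- \<mu>) A)}"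
  let ?g = "\<lambda>\<mu>. mat.span {B + mscale (- \<mu>) A}"
  have "degenerate_points \<Phi> = ?g ` E"
  proof (intro equalityI subsetI)
    fix P assume "P \<in> degenerate_points \<Phi>"
    then obtain C where C: "P = mat.span {C}" "C \<in> \<Phi>" "C \<noteq> 0" "degenerate C"
      by (auto simp: degenerate_points_def)
    then obtain a b where ab: "C = mscale a A + mscale b B" by (auto simp: span mat_span_pair)
    have mdeg: "degenerate (mscale c D) \<longleftrightarrow> degenerate D" if "c \<noteq> 0" for c and D :: "complex^'n^'n"
      using that by (simp add: degenerate_iff matrix_vector_mult_mscale vec.scale_eq_0_iff)
    have "b \<noteq> 0"
    proof
      assume "b = 0"
      then have "C = mscale a A" "a \<noteq> 0" using ab C(3) by auto
      then show False using C(4) ndA mdeg by simp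
    qed
    have "C = mscale b (B + mscale (- (- a / b)) A)"
      using ab \<open>b \<noteq> 0\<close> by (simp add: mscale_def vec_eq_iff algebra_simps)
    then have "P = ?g (- a / b)" "- a / b \<in> E"
      using C(1,4) span_singleton_eqI[OF \<open>b \<noteq> 0\<close>] mdeg[OF \<open>b \<noteq> 0\<close>] unfolding E_def by auto
    then show "P \<in> ?g ` E" by blast
  next
    fix P assume "P \<in> ?g ` E"
    then obtain \<mu> where "P = ?g \<mu>" "degenerate (B + mscale (- \<mu>) A)" by (auto simp: E_def)
    moreover have "B + mscale (- \<mu>) A \<in> \<Phi>"
      using comb[of "- \<mu>" A 1 B] by (simp add: span add.commute)
    moreover have "B + mscale (- \<mu>) A \<noteq> 0"
      using indep[of "- \<mu>" 1] by (auto simp: add.commute)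
    ultimately show "P \<in> degenerate_points \<Phi>" unfolding degenerate_points_def by blast
  qed
  moreover have "inj ?g"
  proof (rule injI)
    fix s t assume "?g s = ?g t"
    then have "B + mscale (- s) A \<in> mat.span {B + mscale (- t) A}" using mat.span_base by blast
    then obtain c where "B + mscale (- s) A = mscale c (B + mscale (- t) A)"
      by (auto simp: mat_span_singleton)
    then have "mscale (c * t - s) A + mscale (1 - c) B = 0"
      by (simp add: mscale_def vec_eq_iff algebra_simps)
    from indep[OF this] show "s = t" by auto
  qed
  ultimately have cardE: "card E = CARD('n)" "finite E"
    using p(2,3) by (auto simp: card_image inj_on_subset dest: finite_imageD)
  then obtain t :: "'n \<Rightarrow> complex" where t: "bij_betw t UNIV E"
    using finite_same_card_bij[of "UNIV :: 'n set" E] by auto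
  then have injt: "inj t" by (simp add: bij_betw_def)
  have "\<exists>v. v \<noteq> 0 \<and> B *v v = t k *s (A *v v)" for k
  proof -
    have "t k \<in> E" using t by (auto simp: bij_betw_def)
    then show ?thesis
      unfolding E_def mem_Collect_eq degenerate_iff matrix_vector_mult_add_rdistrib matrix_vector_mult_mscale
      by (auto simp: add_eq_0_iff)
  qed
  then have "\<exists>v. \<forall>k. v k \<noteq> 0 \<and> B *v v k = t k *s (A *v v k)" by (intro choice allI)
  then obtain v where v: "\<And>k. v k \<noteq> 0" "\<And>k. B *v v k = t k *s (A *v v k)" by blast
  have bilB: "bil B u (v k) = t k * bil A u (v k)" for u k
    by (rule bil_eigenvector[OF v(2)])
  have orth: "bil A (v i) (v j) = 0" if "i \<noteq> j" for i j
  proof -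
    have "t j * bil A (v i) (v j) = t i * bil A (v i) (v j)"
      using bilB[of "v i" j] bilB[of "v j" i] bil_sym[OF q(1)] bil_sym[OF q(2)] by metis
    then show ?thesis using that injt by (auto dest: injD)
  qed
  have "inj ((*v) (cols v))" by (rule eigenvectors_independent[OF injA injt v(2,1)])
  then have surj: "surj ((*v) (cols v))"
    using invertible_if_inj invertible_def matrix_right_invertible_surjective by blast
  have norm: "bil A (v k) (v k) \<noteq> 0" for k
  proof
    assume 0: "bil A (v k) (v k) = 0"
    have "bil A u (v k) = 0" for u
    proof -
      obtain c where c: "u = cols v *v c" using surj by (metis surjD)
      have "bil A (v i) (v k) = 0" for i using 0 orth by (cases "i = k") auto
      then show ?thesis unfolding c cols_mult by (simp add: bil_sum_left bil_scale_left)
    qed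
    then have "A *v v k = 0" using bil_left_zero_iff by blast
    then show False using injA v(1)[of k] unfolding inj_matrix_iff by blast
  qed
  define r where "r k = csqrt (bil A (v k) (v k))" for k
  have r: "r k * r k = bil A (v k) (v k)" "r k \<noteq> 0" for k
    using norm[of k] by (auto simp: r_def simp flip: power2_eq_square)
  define w where "w k = (1 / r k) *s v k" for k
  have w: "bil A (w i) (w j) = (if i = j then 1 else 0)" for i j
    using orth[of i j] r by (auto simp: w_def bil_scale_left bil_scale_right simp flip: r(1))
  have w2: "B *v w i = t i *s (A *v w i)" for i
    by (simp add: w_def vector_scalar_commute v(2) vector_smult_assoc mult.commute)
  note pb = pullback_eigenbasis[OF w w2]
  have "invertible (cols w)"
    using inj_if_pullback_one[of "cols w" A] pb(1) by (auto simp: diagm_one intro: invertible_if_inj)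
  then show thesis
    using that[of "cols w" t] injt by (simp add: span pullback_span_pair pb diag_pencil_def)
qed

lemma nonsingular_diag_pencil:
  fixes t :: "'n::finite \<Rightarrow> complex"
  assumes t: "inj t" and n: "2 \<le> CARD('n)"
  shows "nonsingular_pencil (diag_pencil t)"
proof -
  have "\<not> CARD('n) \<le> 1" using n by simp
  then obtain i j :: 'n where ij: "i \<noteq> j"
    using card_le_Suc0_iff_eq[OF finite, where A = "UNIV :: 'n set"] by auto
  have indep: "a = 0 \<and> b = 0" if "\<And>k. a + b * t k = 0" for a b
  proof -
    have "b * (t i - t j) = (a + b * t i) - (a + b * t j)" by (simp add: algebra_simps)
    then have "b = 0" using that ij t by (auto dest: injD)
    then show ?thesis using that[of i] by simp
  qed
  have "is_pencil (diag_pencil t)"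
    unfolding diag_pencil_def
  proof (rule is_pencil_span_pair)
    fix a b assume "mscale a (diagm (\<lambda>_. 1)) + mscale b (diagm t) = 0"
    then have "diagm (\<lambda>k. a + b * t k) = diagm (\<lambda>_. 0)"
      by (simp add: mscale_diagm add_diagm) (simp add: diagm_def vec_eq_iff)
    then have "a + b * t k = 0" for k by (metis diagm_eq_iff)
    then show "a = 0 \<and> b = 0" by (rule indep)
  qed auto
  moreover have deg: "degenerate (diagm d) \<longleftrightarrow> (\<exists>k. d k = 0)" for d :: "'n \<Rightarrow> complex"
  proof
    assume "\<exists>k. d k = 0"
    then obtain k where k: "d k = 0" ..
    then have "diagm d *v axis k 1 = 0" by (auto simp: vec_eq_iff diagm_mult axis_def)
    then show "degenerate (diagm d)" unfolding degenerate_iff by (metis axis_eq_0_iff zero_neq_one)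
  next
    assume "degenerate (diagm d)"
    then obtain v where "v \<noteq> 0" "diagm d *v v = 0" by (auto simp: degenerate_iff)
    then obtain k where "v $ k \<noteq> 0" by (auto simp: vec_eq_iff)
    moreover have "d k * v $ k = 0" using diagm_mult[of d v k] \<open>diagm d *v v = 0\<close> by simp
    ultimately show "\<exists>k. d k = 0" by auto
  qed
  let ?g = "\<lambda>k. mat.span {diagm (\<lambda>i. t i - t k)}"
  have nz: "diagm d = 0 \<longleftrightarrow> (\<forall>k. d k = 0)" for d :: "'n \<Rightarrow> complex"
    by (auto simp: diagm_def vec_eq_iff)
  have "degenerate_points (diag_pencil t) = range ?g"
  proof (intro equalityI subsetI)
    fix P assume "P \<in> degenerate_points (diag_pencil t)"
    then obtain C where C: "P = mat.span {C}" "C \<in> diag_pencil t" "C \<noteq> 0" "degenerate C"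
      by (auto simp: degenerate_points_def)
    then obtain a b where ab: "C = diagm (\<lambda>i. a + b * t i)" by (auto simp: diag_pencil_eq)
    obtain k where *: "P = mat.span {diagm (\<lambda>i. a + b * t i)}"
      "\<exists>k. a + b * t k \<noteq> 0" "a + b * t k = 0"
    proof -
      have "\<exists>k. a + b * t k \<noteq> 0" using C(3) unfolding ab nz by simp
      moreover have "\<exists>k. a + b * t k = 0" using C(4) unfolding ab deg .
      ultimately show thesis using that C(1) ab by auto
    qed
    have "b \<noteq> 0" using *(2,3) by auto
    moreover have "diagm (\<lambda>i. a + b * t i) = mscale b (diagm (\<lambda>i. t i - t k))"
      using *(3) by (simp add: mscale_diagm diagm_eq_iff fun_eq_iff algebra_simps eq_neg_iff_add_eq_0)
    ultimately have "P = ?g k" unfolding *(1) by (rule span_singleton_eqI)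
    then show "P \<in> range ?g" by blast
  next
    fix P assume "P \<in> range ?g"
    then obtain k where k: "P = ?g k" by blast
    have "diagm (\<lambda>i. t i - t k) \<in> diag_pencil t"
      unfolding diag_pencil_eq by (rule CollectI, rule exI[of _ "- t k"], rule exI[of _ 1]) simp
    moreover have "diagm (\<lambda>i. t i - t k) \<noteq> 0"
      using indep[of "- t k" 1] unfolding nz by auto
    ultimately show "P \<in> degenerate_points (diag_pencil t)"
      unfolding degenerate_points_def k using deg[of "\<lambda>i. t i - t k"] by auto
  qed
  moreover have "inj ?g"
  proof (rule injI)
    fix k l assume "?g k = ?g l"
    then have "diagm (\<lambda>i. t i - t k) \<in> mat.span {diagm (\<lambda>i. t i - t l)}" using mat.span_base by blast
    then obtain c where "diagm (\<lambda>i. t i - t k) = diagm (\<lambda>i. c * (t i - t l))"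
      by (auto simp: mat_span_singleton mscale_diagm)
    then have "t i - t k = c * (t i - t l)" for i by (simp add: diagm_eq_iff fun_eq_iff)
    from this[of l] show "k = l" using t by (auto dest: injD)
  qed
  ultimately show ?thesis by (simp add: nonsingular_pencil_def card_image)
qed

section \<open>Intersections of two diagonal quadrics\<close>

definition diag_cone :: "('m \<Rightarrow> complex) \<Rightarrow> (complex^'m::finite) set" where
  "diag_cone l = {v. (\<Sum>i\<in>UNIV. (v $ i)\<^sup>2) = 0 \<and> (\<Sum>i\<in>UNIV. l i * (v $ i)\<^sup>2) = 0}"

text \<open>\<open>X\<close> is the intersection \<open>\<Sum> y\<^sub>i\<^sup>2 = \<Sum> l\<^sub>i y\<^sub>i\<^sup>2 = 0\<close> in the coordinates given by \<open>S\<close>.\<close>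

definition diagonalizes ::
    "complex^'m^'m \<Rightarrow> ('m \<Rightarrow> complex) \<Rightarrow> (complex^'m) set set \<Rightarrow> bool" where
  "diagonalizes S l X \<longleftrightarrow> invertible S \<and> inj l \<and>
     X = {vec.span {S *v v} | v. v \<noteq> 0 \<and> v \<in> diag_cone l}"

lemma mem_cone_iff: "v \<in> diag_cone l \<longleftrightarrow> (\<forall>C\<in>diag_pencil l. bil C v v = 0)"
proof
  assume "\<forall>C\<in>diag_pencil l. bil C v v = 0"
  moreover have "diagm (\<lambda>_. 1) \<in> diag_pencil l" "diagm l \<in> diag_pencil l"
    unfolding diag_pencil_def by (simp_all add: mat.span_base)
  ultimately have "bil (diagm (\<lambda>_. 1)) v v = 0" "bil (diagm l) v v = 0" by blast+
  then show "v \<in> diag_cone l" by (simp add: diag_cone_def bil_diagm power2_eq_square)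
next
  assume v: "v \<in> diag_cone l"
  show "\<forall>C\<in>diag_pencil l. bil C v v = 0"
  proof
    fix C assume "C \<in> diag_pencil l"
    then obtain a b where C: "C = diagm (\<lambda>i. a + b * l i)" by (auto simp: diag_pencil_eq)
    have "bil C v v = a * (\<Sum>i\<in>UNIV. (v $ i)\<^sup>2) + b * (\<Sum>i\<in>UNIV. l i * (v $ i)\<^sup>2)"
      unfolding C bil_diagm by (simp add: sum.distrib sum_distrib_left algebra_simps power2_eq_square)
    then show "bil C v v = 0" using v by (simp add: diag_cone_def)
  qed
qed

lemma bil_diag_pencil_zero_iff:
  "(\<forall>C\<in>diag_pencil l. bil C u v = 0) \<longleftrightarrow> bil (diagm (\<lambda>_. 1)) u v = 0 \<and> bil (diagm l) u v = 0"
  by (auto simp: diag_pencil_def mat_span_pair bil_matrix_add bil_mscale)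
     (metis add.left_neutral add.right_neutral mat.scale_one mat.scale_zero_left)+

lemma cone_scale: "v \<in> diag_cone l \<Longrightarrow> c *s v \<in> diag_cone l"
  by (simp add: mem_cone_iff bil_scale_left bil_scale_right)

lemma span_singleton_vec: "vec.span {v} = {c *s v | c. True}"
  by (auto simp: vec.span_singleton)

lemma span_singleton_vec_eq_iff:
  assumes "v \<noteq> 0"
  shows "vec.span {u} = vec.span {v} \<longleftrightarrow> (\<exists>c. c \<noteq> 0 \<and> u = c *s v)"
proof
  assume eq: "vec.span {u} = vec.span {v}"
  then have "u \<in> vec.span {v}" "v \<in> vec.span {u}" using vec.span_base[of _ "{u}"] vec.span_base[of _ "{v}"] by auto
  then obtain c d where "u = c *s v" "v = d *s u" unfolding span_singleton_vec by blast
  then show "\<exists>c. c \<noteq> 0 \<and> u = c *s v" using assms by (intro exI[of _ c]) auto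
next
  assume "\<exists>c. c \<noteq> 0 \<and> u = c *s v"
  then obtain c where c: "c \<noteq> 0" "u = c *s v" by blast
  have 1: "a *s u = (a * c) *s v" for a using c by (simp add: vector_smult_assoc)
  have 2: "a *s v = (a / c) *s u" for a using c by (simp add: vector_smult_assoc)
  show "vec.span {u} = vec.span {v}"
    unfolding span_singleton_vec using 1 2 by blast
qed

lemma invertible_mult_zero_iff: "invertible S \<Longrightarrow> S *v v = 0 \<longleftrightarrow> v = 0" for S :: "complex^'m^'m"
  by (metis invertible_def matrix_vector_mul_assoc matrix_vector_mul_lid matrix_vector_mult_0_right)

lemma invertible_mult_eq_iff: "invertible S \<Longrightarrow> S *v u = S *v v \<longleftrightarrow> u = v" for S :: "complex^'m^'m"
  using invertible_mult_zero_iff[of S "u - v"] by (simp add: matrix_vector_mult_diff_distrib)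

lemma diagonalizes_mem_iff:
  assumes "diagonalizes S l X" "v \<noteq> 0"
  shows "vec.span {S *v v} \<in> X \<longleftrightarrow> v \<in> diag_cone l"
proof
  have S: "invertible S" and X: "X = {vec.span {S *v v} | v. v \<noteq> 0 \<and> v \<in> diag_cone l}"
    using assms(1) by (auto simp: diagonalizes_def)
  assume "vec.span {S *v v} \<in> X"
  then obtain u where u: "vec.span {S *v v} = vec.span {S *v u}" "u \<noteq> 0" "u \<in> diag_cone l"
    unfolding X by blast
  then obtain c where "S *v v = c *s (S *v u)"
    using span_singleton_vec_eq_iff[of "S *v u" "S *v v"] invertible_mult_zero_iff[OF S] by auto
  then have "S *v (v - c *s u) = 0" by (simp add: matrix_vector_mult_diff_distrib vector_scalar_commute)
  then have "v = c *s u" using invertible_mult_zero_iff[OF S] by simp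
  then show "v \<in> diag_cone l" using u(3) cone_scale by simp
qed (use assms in \<open>auto simp: diagonalizes_def\<close>)

lemma nonsingular_intersection_diagonalizable:
  fixes X :: "(complex^'m) set set"
  assumes "nonsingular_intersection X"
  obtains S l where "diagonalizes S l X"
proof -
  obtain A B where q: "A \<in> quadratic_forms" "B \<in> quadratic_forms"
    and X: "X = {x \<in> proj_space. \<forall>v\<in>x. bil A v v = 0 \<and> bil B v v = 0}"
    and jac: "\<And>x v s t. x \<in> X \<Longrightarrow> v \<in> x - {0} \<Longrightarrow> s *s (A *v v) + t *s (B *v v) = 0 \<Longrightarrow> s = 0 \<and> t = 0"
    using assms unfolding nonsingular_intersection_def by blast
  have X': "vec.span {v} \<in> X \<longleftrightarrow> bil A v v = 0 \<and> bil B v v = 0" if "v \<noteq> 0" for v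
    using that vec.span_base[of v "{v}"]
    by (auto simp: X proj_space_def span_singleton_vec bil_scale_left bil_scale_right)
  have "\<exists>(S :: complex^'m^'m) l. invertible S \<and> inj l \<and> pullback S ` mat.span {A, B} = diag_pencil l"
  proof (rule jacobian_normal_form[OF q])
    fix v s t assume v: "v \<noteq> 0" "bil A v v = 0" "bil B v v = 0" "s *s (A *v v) + t *s (B *v v) = 0"
    then show "s = 0 \<and> t = 0" using jac[of "vec.span {v}" v s t] X'[OF v(1)] vec.span_base[of v "{v}"] by auto
  qed
  then obtain S :: "complex^'m^'m" and l where S: "invertible S" "inj l" "pullback S ` mat.span {A, B} = diag_pencil l" by blast
  have diag_cone: "bil A (S *v v) (S *v v) = 0 \<and> bil B (S *v v) (S *v v) = 0 \<longleftrightarrow> v \<in> diag_cone l" for v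
    unfolding mem_cone_iff S(3)[symmetric] pullback_span_pair
    by (auto simp: mat_span_pair bil_matrix_add bil_mscale bil_pullback)
       (metis add.left_neutral add.right_neutral mat.scale_one mat.scale_zero_left bil_pullback)+
  have "X = {vec.span {S *v v} | v. v \<noteq> 0 \<and> v \<in> diag_cone l}"
  proof (intro equalityI subsetI)
    fix x assume "x \<in> X"
    then obtain u where u: "x = vec.span {u}" "u \<noteq> 0" by (auto simp: X proj_space_def)
    obtain S' where "S ** S' = mat 1" using S(1) by (auto simp: invertible_def)
    then have "u = S *v (S' *v u)" by (simp add: matrix_vector_mul_assoc)
    then obtain v where v: "u = S *v v" by blast
    then have "v \<noteq> 0" using u(2) by auto
    then show "x \<in> {vec.span {S *v v} | v. v \<noteq> 0 \<and> v \<in> diag_cone l}"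
      using \<open>x \<in> X\<close> X'[OF u(2)] diag_cone[of v] unfolding u(1) v by blast
  next
    fix x assume "x \<in> {vec.span {S *v v} | v. v \<noteq> 0 \<and> v \<in> diag_cone l}"
    then obtain v where v: "x = vec.span {S *v v}" "v \<noteq> 0" "v \<in> diag_cone l" by blast
    then show "x \<in> X" using X'[of "S *v v"] diag_cone[of v] invertible_mult_zero_iff[OF S(1)] by auto
  qed
  then show thesis using that S by (simp add: diagonalizes_def)
qed

text \<open>Square roots of the obvious solution, supported on three coordinates, of the two linear equations for
  the squares. These points are enough to determine all quadrics through the intersection.\<close>

lemma three_term_relation:
  fixes l :: "'m::finite \<Rightarrow> complex"
  assumes ijk: "i \<noteq> j" "i \<noteq> k" "j \<noteq> k"
  shows "\<exists>y \<in> diag_cone l. (y $ i)\<^sup>2 = l j - l k \<and> (y $ j)\<^sup>2 = l k - l i \<and> (y $ k)\<^sup>2 = l i - l j \<and>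
    (\<forall>d. (\<Sum>r\<in>UNIV. d r * (y $ r)\<^sup>2) = d i * (l j - l k) + d j * (l k - l i) + d k * (l i - l j))"
proof -
  define z where "z r = (if r = i then l j - l k else 0) + (if r = j then l k - l i else 0) +
    (if r = k then l i - l j else 0)" for r
  define y :: "complex^'m" where "y = (\<chi> r. csqrt (z r))"
  have y: "(y $ r)\<^sup>2 = z r" for r by (simp add: y_def)
  have sum: "(\<Sum>r\<in>UNIV. d r * (y $ r)\<^sup>2) = d i * (l j - l k) + d j * (l k - l i) + d k * (l i - l j)" for d
    unfolding y z_def by (simp add: distrib_left sum.distrib if_distrib[of "\<lambda>x. _ * x"] cong: if_cong)
  have "y \<in> diag_cone l"
    using sum[of "\<lambda>_. 1"] sum[of l] by (simp add: diag_cone_def algebra_simps)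
  then show ?thesis using sum ijk by (intro bexI[of _ y]) (auto simp: y z_def)
qed

text \<open>The intersection is invariant under changes of signs of the coordinates. Combining four such sign
  changes isolates each mixed term of a form, so that the form is diagonal; the three-term relations then
  say that its coefficients depend on \<open>l\<close> by an affine function.\<close>

lemma quadric_vanishing_on_cone:
  fixes l :: "'m::finite \<Rightarrow> complex"
  assumes D: "D \<in> quadratic_forms" "\<And>y. y \<in> diag_cone l \<Longrightarrow> bil D y y = 0"
    and l: "inj l" and m: "3 \<le> CARD('m)"
  shows "D \<in> diag_pencil l"
proof -
  have third: "\<exists>k. k \<noteq> i \<and> k \<noteq> j" for i j :: 'm
  proof (rule ccontr)
    assume "\<not> ?thesis"
    then have "(UNIV :: 'm set) \<subseteq> {i, j}" by blast
    then have "CARD('m) \<le> card {i, j}" by (intro card_mono) auto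
    also have "\<dots> \<le> 2" by (simp add: card_insert_if)
    finally show False using m by simp
  qed
  have off: "D $ i $ j = 0" if ij: "i \<noteq> j" for i j
  proof -
    obtain k where k: "k \<noteq> i" "k \<noteq> j" using third by blast
    obtain y where y: "y \<in> diag_cone l" "(y $ i)\<^sup>2 = l j - l k" "(y $ j)\<^sup>2 = l k - l i"
      using three_term_relation[of i j k l] ij k by blast
    have nz: "y $ i \<noteq> 0" "y $ j \<noteq> 0" using y(2,3) k l by (auto dest: injD)
    define r where "r = (\<chi> s. if s = i \<or> s = j then 0 else y $ s)"
    define f where "f a b = r + (a *s axis i 1 + b *s axis j 1)" for a b
    have comp: "f a b $ s = (if s = i then a else if s = j then b else y $ s)" for a b s
      using ij by (auto simp: f_def r_def axis_def)
    have "f a b \<in> diag_cone l" if "a\<^sup>2 = (y $ i)\<^sup>2" "b\<^sup>2 = (y $ j)\<^sup>2" for a b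
    proof -
      have "(f a b $ s)\<^sup>2 = (y $ s)\<^sup>2" for s using that by (simp add: comp)
      then show ?thesis using y(1) by (simp add: diag_cone_def)
    qed
    then have 0: "bil D (f a b) (f a b) = 0" if "a\<^sup>2 = (y $ i)\<^sup>2" "b\<^sup>2 = (y $ j)\<^sup>2" for a b
      using D(2) that by blast
    let ?a = "y $ i" and ?b = "y $ j"
    have "8 * (D $ i $ j * (?a * ?b)) = bil D (f ?a ?b) (f ?a ?b) - bil D (f (- ?a) ?b) (f (- ?a) ?b)
        - bil D (f ?a (- ?b)) (f ?a (- ?b)) + bil D (f (- ?a) (- ?b)) (f (- ?a) (- ?b))"
      unfolding f_def bil_add_left bil_add_right bil_scale_left bil_scale_right bil_axis
      using bil_sym[OF D(1), of "axis j 1" "axis i 1"] by (simp add: bil_axis algebra_simps)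
    also have "\<dots> = 0" using 0 by simp
    finally show ?thesis using nz by simp
  qed
  define d where "d i = D $ i $ i" for i
  have Dd: "D = diagm d" using off by (auto simp: vec_eq_iff diagm_def d_def)
  have rel: "d i * (l j - l k) + d j * (l k - l i) + d k * (l i - l j) = 0" if ijk: "i \<noteq> j" "i \<noteq> k" "j \<noteq> k" for i j k
  proof -
    obtain y where "y \<in> diag_cone l"
      "\<forall>d. (\<Sum>r\<in>UNIV. d r * (y $ r)\<^sup>2) = d i * (l j - l k) + d j * (l k - l i) + d k * (l i - l j)"
      using three_term_relation[OF ijk, of l] by blast
    then show ?thesis using D(2)[of y] by (simp add: Dd bil_diagm power2_eq_square)
  qed
  obtain o' p where op: "o' \<noteq> (p :: 'm)" using third by metis
  define b where "b = (d o' - d p) / (l o' - l p)"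
  have ne: "l o' - l p \<noteq> 0" using op l by (auto dest: injD)
  have b: "d o' - d p = b * (l o' - l p)" using ne by (simp add: b_def)
  have "d i = (d o' - b * l o') + b * l i" for i
  proof (cases "i = o' \<or> i = p")
    case True
    then show ?thesis using b by (auto simp: algebra_simps)
  next
    case False
    then have "d i * (l o' - l p) + d o' * (l p - l i) + d p * (l i - l o') = 0"
      using rel[of i o' p] op by auto
    then have "d i * (l o' - l p) = d o' * (l o' - l p) - (d o' - d p) * (l o' - l i)"
      by (simp add: algebra_simps)
    also note b
    finally have "d i * (l o' - l p) = (d o' - b * l o' + b * l i) * (l o' - l p)"
      by (simp add: algebra_simps)
    then show ?thesis using ne by simp
  qed
  then have "d = (\<lambda>i. (d o' - b * l o') + b * l i)" by (rule ext)
  then obtain a where "d = (\<lambda>i. a + b * l i)" by blast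
  then show ?thesis unfolding Dd diag_pencil_eq by blast
qed

text \<open>The pencil \<open>\<Phi>\<^sub>X\<close> is not larger than the pencil that defines \<open>X\<close>.\<close>

lemma forms_vanishing_diagonalized:
  fixes X :: "(complex^'m) set set"
  assumes X: "diagonalizes S l X" and m: "3 \<le> CARD('m)"
  shows "pullback S ` forms_vanishing_on X = diag_pencil l"
proof -
  have S: "invertible S" and l: "inj l" and Xeq: "X = {vec.span {S *v v} | v. v \<noteq> 0 \<and> v \<in> diag_cone l}"
    using X by (auto simp: diagonalizes_def)
  have van: "C \<in> forms_vanishing_on X \<longleftrightarrow> C \<in> quadratic_forms \<and> (\<forall>y\<in>diag_cone l. bil (pullback S C) y y = 0)" for C
  proof -
    have "(\<forall>x\<in>X. \<forall>v\<in>x. bil C v v = 0) \<longleftrightarrow> (\<forall>y\<in>diag_cone l. y \<noteq> 0 \<longrightarrow> (\<forall>c. bil C (c *s (S *v y)) (c *s (S *v y)) = 0))"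
    proof -
      have "(\<forall>x\<in>X. \<forall>v\<in>x. bil C v v = 0) \<longleftrightarrow>
          (\<forall>y. y \<noteq> 0 \<and> y \<in> diag_cone l \<longrightarrow> (\<forall>v\<in>vec.span {S *v y}. bil C v v = 0))"
        unfolding Xeq by (rule iffI) (blast, fast)
      then show ?thesis by (auto simp: span_singleton_vec)
    qed
    also have "\<dots> \<longleftrightarrow> (\<forall>y\<in>diag_cone l. bil (pullback S C) y y = 0)"
    proof -
      have "(\<forall>c. bil C (c *s (S *v y)) (c *s (S *v y)) = 0) \<longleftrightarrow> bil (pullback S C) y y = 0" for y
        by (auto simp: bil_scale_left bil_scale_right bil_pullback)
      moreover have "bil (pullback S C) 0 0 = 0" by simp
      ultimately show ?thesis by metis
    qed
    finally show ?thesis by (simp add: forms_vanishing_on_def)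
  qed
  show ?thesis
  proof (intro equalityI subsetI)
    fix D assume "D \<in> pullback S ` forms_vanishing_on X"
    then show "D \<in> diag_pencil l"
      using l m by (auto simp: van intro!: quadric_vanishing_on_cone pullback_quadratic_form)
  next
    fix D assume D: "D \<in> diag_pencil l"
    obtain S' where S': "S' ** S = mat 1" using S by (auto simp: invertible_def)
    have "D \<in> quadratic_forms" using D by (auto simp: diag_pencil_eq)
    moreover have "pullback S (pullback S' D) = D" by (simp add: pullback_mult[symmetric] S')
    ultimately have "pullback S' D \<in> forms_vanishing_on X"
      using D mem_cone_iff[of _ l] by (simp add: van pullback_quadratic_form)
    then show "D \<in> pullback S ` forms_vanishing_on X"
      using \<open>pullback S (pullback S' D) = D\<close> by (metis image_eqI)
  qed
qed

lemma perp_diagonalized: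
  fixes X :: "(complex^'m) set set"
  assumes X: "diagonalizes S l X" and m: "3 \<le> CARD('m)"
  shows "S *v v \<in> perp X (vec.span {S *v y}) \<longleftrightarrow>
    bil (diagm (\<lambda>_. 1)) y v = 0 \<and> bil (diagm l) y v = 0"
proof -
  have "S *v v \<in> perp X (vec.span {S *v y}) \<longleftrightarrow> (\<forall>A\<in>forms_vanishing_on X. bil A (S *v y) (S *v v) = 0)"
  proof -
    have "(\<forall>u\<in>vec.span {S *v y}. bil A u (S *v v) = 0) \<longleftrightarrow> bil A (S *v y) (S *v v) = 0" for A
      using vec.span_base[of "S *v y" "{S *v y}"] by (auto simp: span_singleton_vec bil_scale_left)
    then show ?thesis by (simp add: perp_def)
  qed
  also have "\<dots> \<longleftrightarrow> (\<forall>C\<in>diag_pencil l. bil C y v = 0)"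
    unfolding forms_vanishing_diagonalized[OF X m, symmetric] by (simp add: bil_pullback)
  finally show ?thesis by (simp add: bil_diag_pencil_zero_iff)
qed

section \<open>The second fundamental form at a point\<close>

lemma poly_nodal_remove:
  "poly (nodal UNIV t) x = (x - t k) * poly (nodal (- {k}) t) x" for t :: "'k::finite \<Rightarrow> complex"
  by (simp add: poly_nodal prod.remove[of UNIV k] Compl_eq_Diff_UNIV)

lemma weight_pair:
  fixes l :: "'m::finite \<Rightarrow> complex"
  assumes "i \<noteq> j"
  shows "weight l i = (l i - l j) * poly (nodal (- {i, j}) l) (l i)"
proof -
  have "- {i} = insert j (- {i, j})" using assms by auto
  then show ?thesis by (simp add: weight_def nodal_def algebra_simps)
qed

text \<open>Up to a scalar, the functional \<open>f \<mapsto> \<Sum> f(l\<^sub>i) / weight\<^sub>i\<close> is the only one on the nodes which annihilates all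
  polynomials of degree at most the number of nodes minus 2: test with the polynomial that vanishes at all
  nodes except two of them.\<close>

lemma constant_if_orthogonal_to_polynomials:
  fixes l u :: "'m::finite \<Rightarrow> complex"
  assumes l: "inj l"
    and orth: "\<And>f. degree f + 2 \<le> CARD('m) \<Longrightarrow> (\<Sum>i\<in>UNIV. u i * poly f (l i) / weight l i) = 0"
  shows "u i = u j"
proof (cases "i = j")
  case False
  let ?f = "nodal (- {i, j}) l"
  have ne: "poly ?f (l i) \<noteq> 0" "poly ?f (l j) \<noteq> 0" "l i \<noteq> l j"
    using l False by (auto simp: poly_nodal_zero_iff dest: injD)
  have "card {i, j} \<le> CARD('m)" by (intro card_mono) auto
  then have "card (- {i, j}) + 2 \<le> CARD('m)" using False by (simp add: Compl_eq_Diff_UNIV card_Diff_subset)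
  then have "0 = (\<Sum>r\<in>UNIV. u r * poly ?f (l r) / weight l r)" using orth[of ?f] by simp
  also have "\<dots> = (\<Sum>r\<in>{i, j}. u r * poly ?f (l r) / weight l r)"
    by (rule sum.mono_neutral_right) (auto simp: poly_nodal_zero_iff)
  also have "\<dots> = u i / (l i - l j) + u j / (l j - l i)"
    using False ne weight_pair[OF False, of l] weight_pair[of j i l] by (simp add: insert_commute)
  also have "u j / (l j - l i) = - (u j / (l i - l j))"
    using minus_divide_right[of "u j" "l i - l j"] by simp
  also have "u i / (l i - l j) + - (u j / (l i - l j)) = (u i - u j) / (l i - l j)"
    by (simp add: diff_divide_distrib)
  finally show ?thesis using ne(3) by simp
qed simp

text \<open>The polynomials of degree at most \<open>n + 1\<close> are spanned by \<open>\<pi>\<close>, \<open>x \<pi>\<close> and the quotients \<open>\<pi> / (x - t k)\<close>, where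
  \<open>\<pi>\<close> is the nodal polynomial of \<open>t\<close>: divide by \<open>\<pi>\<close> and interpolate the remainder.\<close>

lemma orthogonal_to_polynomialsI:
  fixes l :: "'m::finite \<Rightarrow> complex" and t :: "'n::finite \<Rightarrow> complex"
  assumes m: "CARD('m) = CARD('n) + 3" and t: "inj t"
    and k: "\<And>k. (\<Sum>i\<in>UNIV. g i * poly (nodal (- {k}) t) (l i)) = 0"
    and 0: "(\<Sum>i\<in>UNIV. g i * poly (nodal UNIV t) (l i)) = 0"
    and 1: "(\<Sum>i\<in>UNIV. g i * (l i * poly (nodal UNIV t) (l i))) = 0"
    and f: "degree f + 2 \<le> CARD('m)"
  shows "(\<Sum>i\<in>UNIV. g i * poly f (l i)) = 0"
proof -
  let ?p = "nodal UNIV t"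
  define r q where "r = f mod ?p" and "q = f div ?p"
  have fqr: "f = q * ?p + r" unfolding r_def q_def by (rule div_mult_mod_eq[symmetric])
  have dr: "degree r < CARD('n)"
    using degree_mod_less[of ?p f] by (auto simp: r_def zero_less_card_finite)
  have dq: "degree q \<le> 1"
  proof (cases "q = 0")
    case False
    then have "degree (q * ?p) = degree q + CARD('n)" by (simp add: degree_mult_eq)
    then have "degree f = degree q + CARD('n)"
      using dr unfolding fqr by (subst degree_add_eq_left) auto
    then show ?thesis using f m by simp
  qed simp
  have qp: "poly (q * ?p) x = coeff q 0 * poly ?p x + coeff q 1 * (x * poly ?p x)" for x
  proof -
    have "poly q x = coeff q 0 + coeff q 1 * x"
      unfolding poly_altdef using dq by (cases "degree q") (auto simp: le_Suc_eq coeff_eq_0)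
    then show ?thesis by (simp add: algebra_simps)
  qed
  have rv: "poly r x = (\<Sum>k\<in>UNIV. poly r (t k) / weight t k * poly (nodal (- {k}) t) x)" for x
    using poly_interp[of t "\<lambda>k. poly r (t k) / weight t k" x] lagrange[OF t dr] by simp
  have "(\<Sum>i\<in>UNIV. g i * poly f (l i)) = (\<Sum>i\<in>UNIV. g i * poly (q * ?p) (l i)) + (\<Sum>i\<in>UNIV. g i * poly r (l i))"
    unfolding fqr by (simp add: distrib_left sum.distrib)
  also have "(\<Sum>i\<in>UNIV. g i * poly (q * ?p) (l i)) =
      coeff q 0 * (\<Sum>i\<in>UNIV. g i * poly ?p (l i)) + coeff q 1 * (\<Sum>i\<in>UNIV. g i * (l i * poly ?p (l i)))"
    unfolding qp by (simp add: distrib_left sum.distrib sum_distrib_left mult_ac)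
  also have "\<dots> = 0" by (simp add: 0 1)
  also have "(\<Sum>i\<in>UNIV. g i * poly r (l i)) =
      (\<Sum>k\<in>UNIV. poly r (t k) / weight t k * (\<Sum>i\<in>UNIV. g i * poly (nodal (- {k}) t) (l i)))"
    unfolding rv[of "l _"] sum_distrib_left by (subst sum.swap) (simp add: mult_ac)
  also have "\<dots> = 0" by (simp add: k)
  finally show ?thesis by simp
qed

text \<open>The vector \<open>y\<close> is a point of the diagonal intersection that interpolates the polynomial with the
  roots \<open>t\<close> and leading coefficient \<open>c\<close>. No root being a node, all coordinates of \<open>y\<close> are nonzero. The
  tangent space at \<open>y\<close> has an orthonormal frame in which the second fundamental form is the pencil
  \<open>diag_pencil t\<close>.\<close>

locale point_over_roots =
  fixes l :: "'m::finite \<Rightarrow> complex" and t :: "'n::finite \<Rightarrow> complex" and c :: complex and y :: "complex^'m"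
  assumes m: "CARD('m) = CARD('n) + 3" and l: "inj l" and t: "inj t" and c: "c \<noteq> 0"
    and lt: "\<And>i k. l i \<noteq> t k"
    and y: "\<And>i. (y $ i)\<^sup>2 = c * poly (nodal UNIV t) (l i) / weight l i"
begin

lemma y_nonzero: "y $ i \<noteq> 0"
  using y[of i] c lt weight_nonzero[OF l, of i] by (auto simp: poly_nodal_zero_iff)

lemma moment:
  assumes "degree f + 2 \<le> CARD('m)" "\<And>i. g i * poly (nodal UNIV t) (l i) = poly f (l i)"
  shows "(\<Sum>i\<in>UNIV. g i * (y $ i)\<^sup>2) = 0"
proof -
  have "(\<Sum>i\<in>UNIV. g i * (y $ i)\<^sup>2) = c * (\<Sum>i\<in>UNIV. poly f (l i) / weight l i)"
    unfolding y sum_distrib_left assms(2)[symmetric] by (simp add: mult_ac)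
  also have "\<dots> = c * coeff f (CARD('m) - 1)" using divided_difference[OF l, of f] assms(1) by simp
  also have "\<dots> = 0" using assms(1) by (simp add: coeff_eq_0)
  finally show ?thesis .
qed

lemma nodal_at: "poly (nodal UNIV t) (l i) = (l i - t k) * poly (nodal (- {k}) t) (l i)"
  by (rule poly_nodal_remove)

lemma moment_0: "(\<Sum>i\<in>UNIV. (y $ i)\<^sup>2) = 0"
  using moment[of "nodal UNIV t" "\<lambda>_. 1"] m by simp

lemma moment_1: "(\<Sum>i\<in>UNIV. l i * (y $ i)\<^sup>2) = 0"
  using moment[of "[:0, 1:] * nodal UNIV t" l] m by (simp add: degree_pCons_eq)

lemma moment_inverse: "(\<Sum>i\<in>UNIV. 1 / (l i - t k) * (y $ i)\<^sup>2) = 0"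
  using moment[of "nodal (- {k}) t" "\<lambda>i. 1 / (l i - t k)"] m lt
  by (simp add: nodal_at[of _ k] Compl_eq_Diff_UNIV)

definition norm2 :: "'n \<Rightarrow> complex" where
  "norm2 k = (\<Sum>i\<in>UNIV. (y $ i)\<^sup>2 / (l i - t k)\<^sup>2)"

text \<open>This is where the roots have to be simple. The sum is a divided difference of \<open>\<pi>\<^sub>k / (x - t k)\<close>, where
  \<open>\<pi>\<^sub>k\<close> is the product of the other factors; only the polar part \<open>\<pi>\<^sub>k(t k) / (x - t k)\<close> contributes, and its
  divided difference is, up to sign, \<open>\<pi>\<^sub>k(t k)\<close> over the nodal polynomial of \<open>l\<close> at \<open>t k\<close>.\<close>

lemma norm2_nonzero: "norm2 k \<noteq> 0"
proof -
  let ?g = "nodal (- {k}) t" and ?a = "poly (nodal (- {k}) t) (t k)"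
  have a: "?a \<noteq> 0" using t by (auto simp: poly_nodal_zero_iff dest: injD)
  define h where "h = synthetic_div ?g (t k)"
  have h: "poly ?g x = (x - t k) * poly h x + ?a" for x
    using arg_cong[OF synthetic_div_correct'[of "t k" ?g], of "\<lambda>p. poly p x"] by (simp add: h_def algebra_simps)
  have "degree h + 2 \<le> CARD('m)" using m by (simp add: h_def degree_synthetic_div Compl_eq_Diff_UNIV)
  then have h0: "(\<Sum>i\<in>UNIV. poly h (l i) / weight l i) = 0"
    using divided_difference[OF l, of h] by (simp add: coeff_eq_0)
  have inv: "(\<Sum>i\<in>UNIV. 1 / ((t k - l i) * weight l i)) * poly (nodal UNIV l) (t k) = 1"
  proof -
    have "1 = poly (interp l (\<lambda>i. poly 1 (l i) / weight l i)) (t k)"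
      using lagrange[OF l, of 1] m by simp
    also have "\<dots> = (\<Sum>i\<in>UNIV. 1 / weight l i * poly (nodal (- {i}) l) (t k))"
      by (simp add: poly_interp)
    also have "\<dots> = (\<Sum>i\<in>UNIV. 1 / ((t k - l i) * weight l i) * poly (nodal UNIV l) (t k))"
    proof (rule sum.cong)
      fix i
      have "poly (nodal UNIV l) (t k) = (t k - l i) * poly (nodal (- {i}) l) (t k)"
        by (rule poly_nodal_remove)
      then show "1 / weight l i * poly (nodal (- {i}) l) (t k) =
          1 / ((t k - l i) * weight l i) * poly (nodal UNIV l) (t k)"
        using lt[of i k] by (simp add: divide_simps)
    qed simp
    finally show ?thesis by (simp add: sum_distrib_right)
  qed
  have "norm2 k = (\<Sum>i\<in>UNIV. c * (poly h (l i) / weight l i) - c * ?a * (1 / ((t k - l i) * weight l i)))"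
    unfolding norm2_def
  proof (rule sum.cong)
    fix i
    have d: "l i - t k \<noteq> 0" "t k - l i \<noteq> 0" using lt[of i k] by auto
    have "(y $ i)\<^sup>2 / (l i - t k)\<^sup>2 = c * ((l i - t k) * poly h (l i) + ?a) / ((l i - t k) * weight l i)"
      using d unfolding y nodal_at[of i k] h[of "l i"] by (simp add: power2_eq_square divide_simps)
    also have "\<dots> = c * (poly h (l i) / weight l i) + c * ?a * (1 / ((l i - t k) * weight l i))"
      using d weight_nonzero[OF l, of i] by (simp add: divide_simps) (simp add: algebra_simps)
    also have "1 / ((l i - t k) * weight l i) = - (1 / ((t k - l i) * weight l i))"
      using minus_divide_right[of 1 "(t k - l i) * weight l i"] by (simp add: algebra_simps)
    finally show "(y $ i)\<^sup>2 / (l i - t k)\<^sup>2 =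
        c * (poly h (l i) / weight l i) - c * ?a * (1 / ((t k - l i) * weight l i))" by simp
  qed simp
  also have "\<dots> = - c * ?a * (\<Sum>i\<in>UNIV. 1 / ((t k - l i) * weight l i))"
    unfolding sum_subtractf sum_distrib_left[symmetric] h0 by simp
  finally show ?thesis using inv a c by auto
qed

text \<open>The matrix of the member \<open>diag(l) - t k\<close> of the pencil maps the vector \<open>(y\<^sub>i / (l\<^sub>i - t k))\<^sub>i\<close> to \<open>y\<close>, which is
  orthogonal to the whole tangent space. So this vector, normalized here, is in the kernel of the
  restriction of that member.\<close>

definition frame :: "'n \<Rightarrow> complex^'m" where
  "frame k = (\<chi> i. y $ i / ((l i - t k) * csqrt (norm2 k)))"

abbreviation "unit_form \<equiv> diagm (\<lambda>_ :: 'm. 1)"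

lemma sqrt_norm2: "csqrt (norm2 k) * csqrt (norm2 k) = norm2 k" "csqrt (norm2 k) \<noteq> 0"
  using norm2_nonzero[of k] by (simp_all flip: power2_eq_square)

text \<open>For different roots, orthogonality follows by partial fractions from the fact that \<open>y\<close> is orthogonal to
  each vector of the frame.\<close>

lemma unit_form_frame: "bil unit_form (frame j) (frame k) = (if j = k then 1 else 0)"
proof -
  have *: "bil unit_form (frame j) (frame k) =
      (\<Sum>i\<in>UNIV. (y $ i)\<^sup>2 / ((l i - t j) * (l i - t k))) / (csqrt (norm2 j) * csqrt (norm2 k))"
    by (simp add: bil_diagm frame_def power2_eq_square sum_divide_distrib mult_ac)
  show ?thesis
  proof (cases "j = k")
    case True
    then show ?thesis unfolding * using norm2_nonzero[of k] sqrt_norm2(1)[of k]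
      by (simp add: norm2_def power2_eq_square)
  next
    case False
    then have tt: "t j - t k \<noteq> 0" using t by (auto dest: injD)
    have "(\<Sum>i\<in>UNIV. (y $ i)\<^sup>2 / ((l i - t j) * (l i - t k))) =
        (\<Sum>i\<in>UNIV. (1 / (l i - t j) * (y $ i)\<^sup>2 - 1 / (l i - t k) * (y $ i)\<^sup>2) / (t j - t k))"
    proof (rule sum.cong)
      fix i
      have "l i - t j \<noteq> 0" "l i - t k \<noteq> 0" using lt[of i j] lt[of i k] by auto
      then show "(y $ i)\<^sup>2 / ((l i - t j) * (l i - t k)) =
          (1 / (l i - t j) * (y $ i)\<^sup>2 - 1 / (l i - t k) * (y $ i)\<^sup>2) / (t j - t k)"
        using tt by (simp add: divide_simps) (simp add: algebra_simps)
    qed simp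
    also have "\<dots> = 0"
      by (simp only: sum_divide_distrib[symmetric] sum_subtractf moment_inverse) simp
    finally show ?thesis using * False by simp
  qed
qed

lemma unit_form_point_frame: "bil unit_form y (frame k) = 0"
proof -
  have "bil unit_form y (frame k) = (\<Sum>i\<in>UNIV. 1 / (l i - t k) * (y $ i)\<^sup>2) / csqrt (norm2 k)"
    by (simp add: bil_diagm frame_def power2_eq_square sum_divide_distrib mult_ac)
  then show ?thesis by (simp only: moment_inverse) simp
qed

lemma diagm_frame: "(diagm l *v frame k) = t k *s frame k + (1 / csqrt (norm2 k)) *s y"
proof -
  have "l i * (y $ i / ((l i - t k) * s)) = t k * (y $ i / ((l i - t k) * s)) + 1 / s * y $ i"
    if "s \<noteq> 0" for i s
    using that lt[of i k] by (simp add: divide_simps) (simp add: algebra_simps)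
  then show ?thesis using sqrt_norm2(2)[of k] by (simp add: vec_eq_iff diagm_mult frame_def)
qed

lemma bil_diagm_frame: "bil (diagm l) u (frame k) =
    t k * bil unit_form u (frame k) + 1 / csqrt (norm2 k) * bil unit_form u y"
proof -
  have "bil (diagm l) u (frame k) = bil unit_form u (diagm l *v frame k)"
    by (simp add: bil_eq_sum[of "diagm l"]) (simp add: bil_diagm)
  then show ?thesis by (simp add: diagm_frame bil_add_right bil_scale_right)
qed

lemma unit_form_point: "bil unit_form y y = 0" "bil (diagm l) y y = 0"
  using moment_0 moment_1 by (simp_all add: bil_diagm power2_eq_square)

lemma point_mem_cone: "y \<in> diag_cone l" "y \<noteq> 0"
  using moment_0 moment_1 y_nonzero by (auto simp: diag_cone_def)

lemma diagm_point_frame: "bil (diagm l) y (frame k) = 0"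
  by (simp add: bil_diagm_frame unit_form_point_frame unit_form_point)

lemma diagm_frame_frame: "bil (diagm l) (frame j) (frame k) = (if j = k then t k else 0)"
  using unit_form_point_frame[of j] bil_sym[OF diagm_quadratic_form, of _ "frame j" y]
  by (simp add: bil_diagm_frame unit_form_frame)

lemma pullback_frame: "pullback (cols frame) ` diag_pencil l = diag_pencil t"
proof -
  have "pullback (cols frame) unit_form = diagm (\<lambda>_. 1)" "pullback (cols frame) (diagm l) = diagm t"
    by (intro pullback_cols_orthogonal; simp add: unit_form_frame diagm_frame_frame)+
  then show ?thesis by (simp add: diag_pencil_def pullback_span_pair)
qed

text \<open>What makes the frame, together with \<open>y\<close>, span the space orthogonal to \<open>y\<close> for the whole pencil. The
  hypotheses say that the quotients \<open>v\<^sub>i / y\<^sub>i\<close>, divided by the weights, annihilate all polynomials of degree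
  at most \<open>m - 2\<close>; hence these quotients are constant.\<close>

lemma orthogonal_to_frame_imp:
  assumes v: "bil unit_form y v = 0" "bil (diagm l) y v = 0" "\<And>k. bil unit_form (frame k) v = 0"
  shows "\<exists>a. v = a *s y"
proof -
  define u where "u i = v $ i / y $ i" for i
  have yv: "y $ i * v $ i = c * (u i * poly (nodal UNIV t) (l i) / weight l i)" for i
  proof -
    have "y $ i * v $ i = (y $ i)\<^sup>2 * u i" using y_nonzero[of i] by (simp add: u_def power2_eq_square)
    then show ?thesis by (simp add: y mult_ac)
  qed
  define g where "g i = u i / weight l i" for i
  have 0: "(\<Sum>i\<in>UNIV. g i * poly (nodal UNIV t) (l i)) = 0"
  proof -
    have "bil unit_form y v = c * (\<Sum>i\<in>UNIV. g i * poly (nodal UNIV t) (l i))"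
      by (simp add: bil_diagm yv g_def sum_distrib_left)
    then show ?thesis using v(1) c by simp
  qed
  have 1: "(\<Sum>i\<in>UNIV. g i * (l i * poly (nodal UNIV t) (l i))) = 0"
  proof -
    have "bil (diagm l) y v = c * (\<Sum>i\<in>UNIV. g i * (l i * poly (nodal UNIV t) (l i)))"
      unfolding bil_diagm yv g_def sum_distrib_left by (simp add: mult_ac)
    then show ?thesis using v(2) c by simp
  qed
  have k: "(\<Sum>i\<in>UNIV. g i * poly (nodal (- {k}) t) (l i)) = 0" for k
  proof -
    have "bil unit_form (frame k) v = c / csqrt (norm2 k) * (\<Sum>i\<in>UNIV. g i * poly (nodal (- {k}) t) (l i))"
      unfolding bil_diagm sum_distrib_left
    proof (rule sum.cong)
      fix i
      have "1 * (frame k $ i * v $ i) = (y $ i * v $ i) / ((l i - t k) * csqrt (norm2 k))"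
        by (simp add: frame_def)
      also have "\<dots> = c / csqrt (norm2 k) * (g i * poly (nodal (- {k}) t) (l i))"
        unfolding yv nodal_at[of i k] g_def using lt[of i k] by simp
      finally show "1 * (frame k $ i * v $ i) = c / csqrt (norm2 k) * (g i * poly (nodal (- {k}) t) (l i))" .
    qed simp
    then show ?thesis using v(3)[of k] c sqrt_norm2(2)[of k] by simp
  qed
  have "u i = u j" for i j
  proof (rule constant_if_orthogonal_to_polynomials[OF l])
    fix f :: "complex poly" assume "degree f + 2 \<le> CARD('m)"
    from orthogonal_to_polynomialsI[OF m t k 0 1 this]
    show "(\<Sum>i\<in>UNIV. u i * poly f (l i) / weight l i) = 0" by (simp add: g_def)
  qed
  then obtain a where "u i = a" for i by metis
  then have "v $ i = a * y $ i" for i using y_nonzero[of i] by (metis u_def nonzero_divide_eq_eq)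
  then show ?thesis by (intro exI[of _ a]) (simp add: vec_eq_iff)
qed


lemma transpose_frame_mult: "(transpose (cols frame) *v v) $ k = bil unit_form (frame k) v"
  by (simp add: matrix_vector_mult_def transpose_def cols_def bil_diagm del: transpose_matrix_vector)

lemma orthogonal_decomposition:
  assumes v: "bil unit_form y v = 0" "bil (diagm l) y v = 0"
  shows "\<exists>a. v = a *s y + cols frame *v (transpose (cols frame) *v v)"
proof -
  define u where "u = transpose (cols frame) *v v"
  have "\<exists>a. v - cols frame *v u = a *s y"
  proof (rule orthogonal_to_frame_imp)
    have diff: "bil A w (v - v') = bil A w v - bil A w v'" for A :: "complex^'m^'m" and w v'
      using bil_add_right[of A w "v - v'" v'] by simp
    show "bil unit_form y (v - cols frame *v u) = 0"
      by (simp add: diff v cols_mult bil_sum_right bil_scale_right unit_form_point_frame)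
    show "bil (diagm l) y (v - cols frame *v u) = 0"
      by (simp add: diff v cols_mult bil_sum_right bil_scale_right diagm_point_frame)
    fix k
    have "bil unit_form (frame k) (cols frame *v u) = (\<Sum>j\<in>UNIV. if j = k then u $ k else 0)"
      unfolding cols_mult bil_sum_right[OF finite] bil_scale_right
      by (intro sum.cong) (auto simp: unit_form_frame)
    also have "\<dots> = bil unit_form (frame k) v"
      using transpose_frame_mult[of v k] by (simp add: u_def del: transpose_matrix_vector)
    finally show "bil unit_form (frame k) (v - cols frame *v u) = 0" by (simp add: diff)
  qed
  then show ?thesis unfolding u_def by (metis diff_add_cancel)
qed

lemma frame_range_orthogonal:
  "bil unit_form y (cols frame *v u) = 0" "bil (diagm l) y (cols frame *v u) = 0"
  by (simp_all add: cols_mult bil_sum_right bil_scale_right unit_form_point_frame diagm_point_frame)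

lemma inj_frame: "inj ((*v) (cols frame))"
proof (rule inj_if_pullback_one)
  show "pullback (cols frame) unit_form = mat 1"
    unfolding diagm_one[symmetric] by (rule pullback_cols_orthogonal) (simp add: unit_form_frame)
qed

lemma frame_disjoint_point: "cols frame *v u = a *s y \<Longrightarrow> u = 0"
proof -
  assume eq: "cols frame *v u = a *s y"
  have "u $ k = 0" for k
  proof -
    have "bil unit_form (frame k) (cols frame *v u) = (\<Sum>j\<in>UNIV. if j = k then u $ k else 0)"
      unfolding cols_mult bil_sum_right[OF finite] bil_scale_right
      by (intro sum.cong) (auto simp: unit_form_frame)
    moreover have "bil unit_form (frame k) (a *s y) = 0"
      using unit_form_point_frame[of k] bil_sym[OF diagm_quadratic_form, of _ y "frame k"]
      by (simp add: bil_scale_right)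
    ultimately show ?thesis using eq by simp
  qed
  then show "u = 0" by (simp add: vec_eq_iff)
qed

context
  fixes X :: "(complex^'m) set set" and S :: "complex^'m^'m"
  assumes X: "diagonalizes S l X"
begin

lemma invertible_S: "invertible S"
  using X by (simp add: diagonalizes_def)

lemma S_zero_iff: "S *v v = 0 \<longleftrightarrow> v = 0"
  by (rule invertible_mult_zero_iff[OF invertible_S])

lemma S_eq_iff: "S *v u = S *v v \<longleftrightarrow> u = v"
  by (rule invertible_mult_eq_iff[OF invertible_S])

lemma S_surj: "\<exists>v. w = S *v v"
  using invertible_S by (metis invertible_def matrix_vector_mul_assoc matrix_vector_mul_lid)

lemma mem_perp_iff: "S *v v \<in> perp X (vec.span {S *v y}) \<longleftrightarrow>
    bil unit_form y v = 0 \<and> bil (diagm l) y v = 0"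
  by (rule perp_diagonalized[OF X]) (simp add: m)

lemma point_mem: "vec.span {S *v y} \<in> X"
  using diagonalizes_mem_iff[OF X point_mem_cone(2)] point_mem_cone(1) by simp

lemma tangent_frame_frame: "tangent_frame X (vec.span {S *v y}) (S ** cols frame)"
proof -
  have range: "range ((*v) (S ** cols frame)) = {S *v (cols frame *v u) | u. True}"
    by (auto simp: matrix_vector_mul_assoc)
  have "inj ((*v) (S ** cols frame))"
    unfolding inj_matrix_iff using inj_frame
    by (simp add: matrix_vector_mul_assoc[symmetric] S_zero_iff inj_matrix_iff)
  moreover have "vec.span {S *v y} \<inter> range ((*v) (S ** cols frame)) = {0}"
  proof (intro equalityI subsetI)
    fix w assume "w \<in> vec.span {S *v y} \<inter> range ((*v) (S ** cols frame))"
    then obtain a u where w: "w = a *s (S *v y)" "w = S *v (cols frame *v u)"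
      unfolding range span_singleton_vec by blast
    then have "S *v (cols frame *v u) = S *v (a *s y)" by (simp add: vector_scalar_commute)
    then have "cols frame *v u = a *s y" by (simp only: S_eq_iff)
    then have "u = 0" by (rule frame_disjoint_point)
    then show "w \<in> {0}" using w(2) by simp
  next
    fix w :: "complex^'m" assume "w \<in> {0}"
    moreover have "0 \<in> range ((*v) (S ** cols frame))" by (rule range_eqI[of _ _ 0]) simp
    ultimately show "w \<in> vec.span {S *v y} \<inter> range ((*v) (S ** cols frame))"
      by (simp add: vec.span_zero)
  qed
  moreover have "{u + w | u w. u \<in> vec.span {S *v y} \<and> w \<in> range ((*v) (S ** cols frame))} =
      perp X (vec.span {S *v y})"
  proof (intro equalityI subsetI)
    fix z assume "z \<in> {u + w | u w. u \<in> vec.span {S *v y} \<and> w \<in> range ((*v) (S ** cols frame))}"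
    then obtain a u where "z = a *s (S *v y) + S *v (cols frame *v u)"
      unfolding range span_singleton_vec by blast
    then have z: "z = S *v (a *s y + cols frame *v u)"
      by (simp add: matrix_vector_right_distrib vector_scalar_commute)
    show "z \<in> perp X (vec.span {S *v y})"
      unfolding z mem_perp_iff
      by (simp add: bil_add_right bil_scale_right unit_form_point frame_range_orthogonal)
  next
    fix z assume z: "z \<in> perp X (vec.span {S *v y})"
    obtain v where v: "z = S *v v" using S_surj by blast
    obtain a where "v = a *s y + cols frame *v (transpose (cols frame) *v v)"
      using z orthogonal_decomposition unfolding v mem_perp_iff by blast
    then have "z = a *s (S *v y) + S *v (cols frame *v (transpose (cols frame) *v v))"
      unfolding v by (metis matrix_vector_right_distrib vector_scalar_commute)
    then show "z \<in> {u + w | u w. u \<in> vec.span {S *v y} \<and> w \<in> range ((*v) (S ** cols frame))}"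
      unfolding range span_singleton_vec by blast
  qed
  ultimately show ?thesis by (simp add: tangent_frame_def Let_def)
qed

text \<open>Two tangent frames differ by an invertible matrix and by multiples of \<open>y\<close>, and \<open>y\<close> is in the kernel of
  all forms restricted to its orthogonal space. So the arbitrary frame in the definition of the second
  fundamental form may be replaced by the explicit one.\<close>

lemma pullback_tangent_frame:
  fixes L :: "complex^'n^'m"
  assumes L: "tangent_frame X (vec.span {S *v y}) L"
  shows "\<exists>T :: complex^'n^'n. invertible T \<and> pullback L ` forms_vanishing_on X = pullback T ` diag_pencil t"
proof -
  let ?F = "forms_vanishing_on X"
  obtain S' where S': "S ** S' = mat 1" "S' ** S = mat 1" using invertible_S by (auto simp: invertible_def)
  define K where "K = S' ** L"
  have LK: "L = S ** K" by (simp add: K_def matrix_mul_assoc S')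
  define T where "T = transpose (cols frame) ** K"
  have injL: "inj ((*v) L)" and disj: "vec.span {S *v y} \<inter> range ((*v) L) = {0}"
    and perp: "{u + w | u w. u \<in> vec.span {S *v y} \<and> w \<in> range ((*v) L)} = perp X (vec.span {S *v y})"
    using L by (auto simp: tangent_frame_def Let_def)
  have orth: "bil unit_form y (K *v u) = 0 \<and> bil (diagm l) y (K *v u) = 0" for u
  proof -
    have "0 + L *v u \<in> perp X (vec.span {S *v y})"
      unfolding perp[symmetric] using vec.span_zero by blast
    then have "S *v (K *v u) \<in> perp X (vec.span {S *v y})"
      by (simp add: LK matrix_vector_mul_assoc)
    then show ?thesis by (simp only: mem_perp_iff)
  qed
  have dec: "\<exists>a. K *v u = a *s y + cols frame *v (T *v u)" for u
    using orthogonal_decomposition[of "K *v u"] orth[of u]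
    by (simp add: T_def matrix_vector_mul_assoc[symmetric] del: transpose_matrix_vector)
  have "inj ((*v) T)"
    unfolding inj_matrix_iff
  proof (intro allI impI)
    fix u assume "T *v u = 0"
    then obtain a where "K *v u = a *s y" using dec[of u] by auto
    then have "L *v u = a *s (S *v y)"
      by (simp add: LK matrix_vector_mul_assoc[symmetric] vector_scalar_commute)
    then have "L *v u \<in> vec.span {S *v y} \<inter> range ((*v) L)"
      unfolding span_singleton_vec by blast
    then have "L *v u = 0" unfolding disj by simp
    then show "u = 0" using injL by (simp add: inj_matrix_iff)
  qed
  then have T: "invertible T" by (rule invertible_if_inj)
  have pb: "pullback K C = pullback T (pullback (cols frame) C)" if C: "C \<in> diag_pencil l" for C
  proof (rule matrix_eq_bilI)
    fix u v
    obtain a b where ab: "K *v u = a *s y + cols frame *v (T *v u)" "K *v v = b *s y + cols frame *v (T *v v)"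
      using dec by blast
    have C0: "bil C y w = 0" if "bil unit_form y w = 0" "bil (diagm l) y w = 0" for w
      using that C bil_diag_pencil_zero_iff[of l y w] by blast
    have q: "C \<in> quadratic_forms" using C by (auto simp: diag_pencil_eq)
    have "bil C (cols frame *v w) y = 0" for w
      using C0[OF frame_range_orthogonal] bil_sym[OF q, of _ y] by simp
    then show "bil (pullback K C) u v = bil (pullback T (pullback (cols frame) C)) u v"
      unfolding bil_pullback ab bil_add_left bil_add_right bil_scale_left bil_scale_right
      by (simp add: C0[OF unit_form_point] C0[OF frame_range_orthogonal])
  qed
  have "pullback L ` ?F = pullback K ` pullback S ` ?F"
    by (simp add: LK pullback_mult image_image)
  also have "\<dots> = pullback K ` diag_pencil l"
    using forms_vanishing_diagonalized[OF X] m by simp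
  also have "\<dots> = pullback T ` pullback (cols frame) ` diag_pencil l"
    by (simp add: pb image_image)
  also have "\<dots> = pullback T ` diag_pencil t" by (simp only: pullback_frame)
  finally show ?thesis using T by blast
qed

lemma second_fundamental_form_at_point:
  "\<exists>T :: complex^'n^'n. invertible T \<and> second_fundamental_form X (vec.span {S *v y}) = pullback T ` diag_pencil t"
proof -
  define L :: "complex^'n^'m" where "L = (SOME L. tangent_frame X (vec.span {S *v y}) L)"
  have "tangent_frame X (vec.span {S *v y}) L"
    unfolding L_def by (rule someI, rule tangent_frame_frame)
  then obtain T where T: "invertible T" "pullback L ` forms_vanishing_on X = pullback T ` diag_pencil t"
    using pullback_tangent_frame by blast
  have "second_fundamental_form X (vec.span {S *v y}) = mat.span (pullback T ` diag_pencil t)"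
    unfolding second_fundamental_form_def L_def[symmetric] T(2) ..
  also have "\<dots> = pullback T ` diag_pencil t"
    unfolding diag_pencil_def pullback_span_pair by (rule mat.span_span)
  finally show ?thesis using T(1) by blast
qed

end

end

section \<open>Surjectivity of the moduli map\<close>

lemma (in point_over_roots) moduli_map_at_point:
  fixes X :: "(complex^'m) set set"
  assumes X: "diagonalizes S l X" and n: "2 \<le> CARD('n)"
  shows "vec.span {S *v y} \<in> nonsingular_II_locus TYPE('n) X"
    and "moduli_map X (vec.span {S *v y}) = pencil_class (diag_pencil t)"
proof -
  obtain T :: "complex^'n^'n" where T: "invertible T"
    "second_fundamental_form X (vec.span {S *v y}) = pullback T ` diag_pencil t"
    using second_fundamental_form_at_point[OF X] by blast
  show "vec.span {S *v y} \<in> nonsingular_II_locus TYPE('n) X"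
    using nonsingular_pencil_pullback[OF nonsingular_diag_pencil[OF t n] T(1)] point_mem[OF X]
    by (simp add: nonsingular_II_locus_def T(2))
  show "moduli_map X (vec.span {S *v y}) = pencil_class (diag_pencil t)"
    unfolding moduli_map_def T(2) by (rule pencil_class_pullback[OF T(1)])
qed

lemma shift_avoiding:
  fixes l :: "'m::finite \<Rightarrow> complex" and t :: "'n::finite \<Rightarrow> complex"
  shows "\<exists>s. \<forall>i k. l i \<noteq> t k + s"
proof -
  have "\<not> (UNIV :: complex set) \<subseteq> (\<lambda>(i, k). l i - t k) ` UNIV"
    using infinite_UNIV_char_0[where 'a = complex] by (meson finite finite_imageI finite_subset)
  then obtain s where "s \<notin> (\<lambda>(i, k). l i - t k) ` UNIV" by blast
  then have *: "s \<noteq> l i - t k" for i k by auto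
  have "l i \<noteq> t k + s" for i k using *[of i k] by (simp add: eq_diff_eq add.commute eq_commute)
  then show ?thesis by blast
qed

lemma point_over_roots_exists:
  fixes l :: "'m::finite \<Rightarrow> complex" and t :: "'n::finite \<Rightarrow> complex"
  assumes "CARD('m) = CARD('n) + 3" "inj l" "inj t" "\<And>i k. l i \<noteq> t k"
  shows "point_over_roots l t 1 (\<chi> i. csqrt (poly (nodal UNIV t) (l i) / weight l i))"
  using assms by unfold_locales auto

lemma topspace_moduli_PQ:
  "topspace (moduli_PQ :: (complex^'n^'n) set set topology) = pencil_class ` {\<Phi>. nonsingular_pencil \<Phi>}"
proof -
  have "\<Phi> \<in> (\<lambda>(A, B). mat.span {A, B}) ` pencil_bases" if \<Phi>: "nonsingular_pencil \<Phi>" for \<Phi> :: "(complex^'n^'n) set"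
  proof -
    have p: "is_pencil \<Phi>" using \<Phi> by (simp add: nonsingular_pencil_def)
    then obtain A B where "\<Phi> = mat.span {A, B}" using pencil_basis by blast
    then show ?thesis using p by (auto simp: pencil_bases_def)
  qed
  then have "topspace pencil_zariski \<inter> {\<Phi>. nonsingular_pencil \<Phi>} = {\<Phi> :: (complex^'n^'n) set. nonsingular_pencil \<Phi>}"
    by (auto simp: pencil_zariski_def)
  then show ?thesis by (simp add: moduli_PQ_def)
qed

text \<open>The roots of a nonsingular pencil, translated away from the nodes, are
  the roots of a polynomial of degree \<open>n\<close>, and every such polynomial is interpolated by a point of the
  intersection, because each complex number has a square root.\<close>

lemma moduli_map_image:
  fixes X :: "(complex^'m) set set"
  assumes X: "diagonalizes S l X" and m: "CARD('m) = CARD('n::finite) + 3" and n: "2 \<le> CARD('n)"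
  shows "moduli_map X ` nonsingular_II_locus TYPE('n) X =
    topspace (moduli_PQ :: (complex^'n^'n) set set topology)"
proof (intro equalityI subsetI)
  fix c :: "(complex^'n^'n) set set" assume "c \<in> moduli_map X ` nonsingular_II_locus TYPE('n) X"
  then show "c \<in> topspace moduli_PQ"
    unfolding topspace_moduli_PQ by (auto simp: moduli_map_def nonsingular_II_locus_def)
next
  fix c assume "c \<in> topspace (moduli_PQ :: (complex^'n^'n) set set topology)"
  then obtain \<Phi> where \<Phi>: "nonsingular_pencil \<Phi>" "c = pencil_class \<Phi>"
    unfolding topspace_moduli_PQ by blast
  obtain T :: "complex^'n^'n" and t0 where T: "invertible T" "inj t0" "pullback T ` \<Phi> = diag_pencil t0"
    using nonsingular_pencil_normal_form[OF \<Phi>(1)] by blast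
  obtain s where s: "\<And>i k. l i \<noteq> t0 k + s" using shift_avoiding by metis
  define t where "t k = t0 k + s" for k
  define y where "y = (\<chi> i. csqrt (poly (nodal UNIV t) (l i) / weight l i))"
  have "inj l" using X by (simp add: diagonalizes_def)
  moreover have "inj t" using T(2) by (simp add: t_def inj_def)
  ultimately interpret point_over_roots l t 1 y
    unfolding y_def using m s by (intro point_over_roots_exists) (auto simp: t_def)
  have "c = pencil_class (diag_pencil t)"
    unfolding \<Phi>(2) t_def diag_pencil_shift T(3)[symmetric] by (rule pencil_class_pullback[OF T(1), symmetric])
  then show "c \<in> moduli_map X ` nonsingular_II_locus TYPE('n) X"
    using moduli_map_at_point[OF X n] by (metis image_eqI)
qed

lemma moduli_map_dominant:
  fixes X :: "(complex^'m) set set"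
  assumes "diagonalizes S l X" "CARD('m) = CARD('n::finite) + 3" "2 \<le> CARD('n)"
  shows "dominant_map (nonsingular_II_locus TYPE('n) X) moduli_PQ
    (moduli_map X :: (complex^'m) set \<Rightarrow> (complex^'n^'n) set set)"
  unfolding dominant_map_def moduli_map_image[OF assms] by simp

section \<open>Branches of the correspondence between two intersections\<close>

text \<open>A sector on which the real part of the square is positive. A quotient of two of its elements has
  positive real part, and this pins down the sign of a square root.\<close>

definition sector :: "complex set" where
  "sector = {w. \<bar>Im w\<bar> < Re w}"

lemma sector_ratio:
  assumes "w \<in> sector" "c * w \<in> sector"
  shows "0 < Re c"
proof -
  have "\<bar>Im (c * w) * Im w\<bar> < Re (c * w) * Re w"
    unfolding abs_mult using assms by (intro mult_strict_mono') (auto simp: sector_def)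
  then have "0 < Re (c * w) * Re w + Im (c * w) * Im w" by linarith
  also have "\<dots> = Re c * ((Re w)\<^sup>2 + (Im w)\<^sup>2)"
    by (simp add: algebra_simps power2_eq_square)
  finally show ?thesis by (simp add: zero_less_mult_iff) (smt (verit) zero_le_power2)
qed

lemma csqrt_mem_sector:
  assumes "0 < Re z" shows "csqrt z \<in> sector"
proof -
  have "Re ((csqrt z)\<^sup>2) > 0" using assms by simp
  then have "(Im (csqrt z))\<^sup>2 < (Re (csqrt z))\<^sup>2" unfolding Re_power2 by simp
  then have "\<bar>Im (csqrt z)\<bar> < \<bar>Re (csqrt z)\<bar>" using abs_le_square_iff not_le by blast
  then show ?thesis using Re_csqrt[of z] by (simp add: sector_def)
qed

lemma Re_square_sector: "w \<in> sector \<Longrightarrow> 0 < Re (w\<^sup>2)"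
  using power_strict_mono[of "\<bar>Im w\<bar>" "Re w" 2] unfolding Re_power2 by (simp add: sector_def)

lemma csqrt_square_sector: "w \<in> sector \<Longrightarrow> csqrt (w\<^sup>2) = w"
  by (intro csqrt_square) (auto simp: sector_def)

lemma csqrt_square_mult:
  assumes "0 < Re z" "0 < Re (c\<^sup>2 * z)" "0 < Re c"
  shows "csqrt (c\<^sup>2 * z) = c * csqrt z"
proof -
  have "(csqrt (c\<^sup>2 * z))\<^sup>2 = (c * csqrt z)\<^sup>2" by (simp add: power_mult_distrib)
  then have "csqrt (c\<^sup>2 * z) = c * csqrt z \<or> csqrt (c\<^sup>2 * z) = - c * csqrt z"
    unfolding power2_eq_iff by simp
  moreover have "csqrt (c\<^sup>2 * z) \<noteq> - c * csqrt z"
  proof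
    assume "csqrt (c\<^sup>2 * z) = - c * csqrt z"
    then have "0 < Re (- c)"
      using sector_ratio[of "csqrt z" "- c"] csqrt_mem_sector assms(1,2) by metis
    then show False using assms(3) by simp
  qed
  ultimately show ?thesis by blast
qed

text \<open>Up to a constant factor, the polynomial whose roots are the degenerate members of the second
  fundamental form at \<open>x\<close>. It depends on the squares of the coordinates only, and it is a linear function
  of them.\<close>

definition profile :: "('m::finite \<Rightarrow> complex) \<Rightarrow> complex^'m \<Rightarrow> complex poly" where
  "profile l x = interp l (\<lambda>i. (x $ i)\<^sup>2)"

lemma poly_profile: "poly (profile l x) z = (\<Sum>k\<in>UNIV. (x $ k)\<^sup>2 * poly (nodal (- {k}) l) z)"
  by (simp add: profile_def poly_interp)

lemma coeff_profile: "coeff (profile l x) n = (\<Sum>k\<in>UNIV. (x $ k)\<^sup>2 * coeff (nodal (- {k}) l) n)"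
  by (simp add: profile_def interp_def coeff_sum)

lemma poly_profile_node: "poly (profile l x) (l i) = (x $ i)\<^sup>2 * weight l i"
  by (simp add: profile_def poly_interp_node)

lemma profile_scale: "profile l (c *s x) = smult (c\<^sup>2) (profile l x)"
  by (rule poly_eqI) (simp add: coeff_profile power_mult_distrib sum_distrib_left mult.assoc)

text \<open>The square of the \<open>i\<close>-th coordinate of a point with nodes \<open>l'\<close> and the same profile as \<open>x\<close>, divided by the
  square of the coordinate \<open>b i\<close> of a base point. Near the base point it is close to 1, so that the principal
  square root is holomorphic there.\<close>

definition target :: "('m::finite \<Rightarrow> complex) \<Rightarrow> ('m \<Rightarrow> complex) \<Rightarrow> ('m \<Rightarrow> complex) \<Rightarrow> complex^'m \<Rightarrow> 'm \<Rightarrow> complex" where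
  "target l l' b x i = poly (profile l x) (l' i) / (weight l' i * (b i)\<^sup>2)"

definition branch :: "('m::finite \<Rightarrow> complex) \<Rightarrow> ('m \<Rightarrow> complex) \<Rightarrow> ('m \<Rightarrow> complex) \<Rightarrow> complex^'m \<Rightarrow> complex^'m" where
  "branch l l' b x = (\<chi> i. b i * csqrt (target l l' b x i))"

lemma target_scale: "target l l' b (c *s x) i = c\<^sup>2 * target l l' b x i"
  by (simp add: target_def profile_scale)

text \<open>An open set on which the branch is defined; on the intersection itself, the branch in the opposite
  direction is its inverse. The conditions are arranged so that exchanging \<open>(l, a)\<close> with \<open>(l', b)\<close> gives the chart around the other base
  point.\<close>

definition chart :: "('m::finite \<Rightarrow> complex) \<Rightarrow> ('m \<Rightarrow> complex) \<Rightarrow> ('m \<Rightarrow> complex) \<Rightarrow> ('m \<Rightarrow> complex) \<Rightarrow>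
    real \<Rightarrow> ('n::finite \<Rightarrow> complex) \<Rightarrow> (complex^'m) set" where
  "chart l l' a b \<epsilon> \<tau> = {x. (\<forall>i. x $ i / a i \<in> sector) \<and> (\<forall>i. 0 < Re (target l l' b x i)) \<and>
     near_simple_roots \<epsilon> \<tau> (profile l x)}"

lemma continuous_on_target: "continuous_on A (\<lambda>x. target l l' b x i)"
  unfolding target_def poly_profile divide_inverse by (intro continuous_intros)

lemma open_chart:
  fixes a b :: "'m::finite \<Rightarrow> complex" and \<tau> :: "'n::finite \<Rightarrow> complex"
  shows "open (chart l l' a b \<epsilon> \<tau>)"
proof -
  have "chart l l' a b \<epsilon> \<tau> = (\<Inter>i. {x. \<bar>Im (x $ i / a i)\<bar> < Re (x $ i / a i)}) \<inter>
     (\<Inter>i. {x. 0 < Re (target l l' b x i)}) \<inter>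
     {x. coeff (profile l x) (CARD('n)) \<noteq> 0} \<inter>
     (\<Inter>k. {x. cmod (poly (profile l x) (\<tau> k)) < \<epsilon> ^ CARD('n) * cmod (coeff (profile l x) (CARD('n)))})"
    by (auto simp: chart_def sector_def near_simple_roots_def)
  also have "open \<dots>"
    unfolding poly_profile coeff_profile divide_inverse
    by (intro open_Int open_INT finite ballI open_Collect_less open_Collect_neq continuous_intros continuous_on_target)
  finally show ?thesis .
qed

lemma bounded_linear_axis: "bounded_linear (axis i :: complex \<Rightarrow> complex^'m)"
  unfolding linear_conv_bounded_linear[symmetric]
  by (rule linearI) (auto simp: vec_eq_iff axis_def)

lemma has_derivative_branch:
  assumes "\<And>i. 0 < Re (target l l' b x i)"
  shows "\<exists>D. (branch l l' b has_derivative D) (at x) \<and> (\<forall>c u. D (c *s u) = c *s D u)"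
proof -
  define q where "q i u = (\<Sum>k\<in>UNIV. 2 * x $ k * u $ k * poly (nodal (- {k}) l) (l' i)) / (weight l' i * (b i)\<^sup>2)"
    for i and u :: "complex^'a"
  have q: "((\<lambda>x. target l l' b x i) has_derivative q i) (at x)" for i
    unfolding target_def poly_profile q_def divide_inverse
    by (auto intro!: derivative_eq_intros bounded_linear.has_derivative[OF bounded_linear_vec_nth]
        simp: mult_ac)
  define D where "D u = (\<Sum>i\<in>UNIV. axis i (b i * (inverse (2 * csqrt (target l l' b x i)) * q i u)))" for u
  have csqrt: "((\<lambda>x. csqrt (target l l' b x i)) has_derivative
      (\<lambda>u. inverse (2 * csqrt (target l l' b x i)) * q i u)) (at x)" for i
  proof -
    have "target l l' b x i \<notin> \<real>\<^sub>\<le>\<^sub>0"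
      using assms[of i] by (auto simp: complex_nonpos_Reals_iff)
    from has_field_derivative_csqrt[OF this]
    have "(csqrt has_derivative (*) (inverse (2 * csqrt (target l l' b x i)))) (at (target l l' b x i))"
      by (simp add: has_field_derivative_def)
    from has_derivative_compose[OF q this] show ?thesis .
  qed
  have "((\<lambda>x. \<Sum>i\<in>UNIV. axis i (b i * csqrt (target l l' b x i))) has_derivative D) (at x)"
    unfolding D_def
    by (intro has_derivative_sum bounded_linear.has_derivative[OF bounded_linear_axis]
        has_derivative_mult_right csqrt)
  moreover have "(\<lambda>x. \<Sum>i\<in>UNIV. axis i (b i * csqrt (target l l' b x i))) = branch l l' b"
    by (rule ext) (simp add: branch_def vec_eq_iff axis_def)
  moreover have "q i (c *s u) = c * q i u" for c u i
    by (simp add: q_def sum_distrib_left mult_ac)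
  then have "D (c *s u) = c *s D u" for c u
    unfolding D_def vec.scale_sum_right by (intro sum.cong) (auto simp: vec_eq_iff axis_def)
  ultimately show ?thesis by metis
qed

lemma holomorphic_map_branch:
  fixes S' :: "complex^'m^'k" and Q :: "complex^'j^'m"
  shows "holomorphic_map {u. Q *v u \<in> chart l l' a b \<epsilon> \<tau>} (\<lambda>u. S' *v branch l l' b (Q *v u))"
  unfolding holomorphic_map_def
proof
  fix u assume "u \<in> {u. Q *v u \<in> chart l l' a b \<epsilon> \<tau>}"
  then obtain D where D: "(branch l l' b has_derivative D) (at (Q *v u))" "\<And>c u. D (c *s u) = c *s D u"
    using has_derivative_branch[of l l' b "Q *v u"] by (auto simp: chart_def)
  have "((*v) Q has_derivative (*v) Q) (at u)"
    by (intro bounded_linear.has_derivative[OF matrix_vector_mul_bounded_linear] has_derivative_ident)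
  from has_derivative_compose[OF this D(1)]
  have "((\<lambda>u. S' *v branch l l' b (Q *v u)) has_derivative (\<lambda>h. S' *v D (Q *v h))) (at u)"
    by (intro bounded_linear.has_derivative[OF matrix_vector_mul_bounded_linear])
  moreover have "S' *v D (Q *v (c *s h)) = c *s (S' *v D (Q *v h))" for c h
    by (simp add: vector_scalar_commute D(2))
  ultimately show "\<exists>D. ((\<lambda>u. S' *v branch l l' b (Q *v u)) has_derivative D) (at u) \<and>
      (\<forall>c u. D (c *s u) = c *s D u)" by blast
qed

text \<open>The numbers \<open>a\<close> and \<open>b\<close> will be the coordinates of base points on the two intersections, and \<open>\<tau>\<close> the
  common roots of the profiles of these base points.\<close>

locale chart_pair =
  fixes l l' a b :: "'m::finite \<Rightarrow> complex" and \<epsilon> :: real and \<tau> :: "'n::finite \<Rightarrow> complex"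
  assumes m: "CARD('m) = CARD('n) + 3" and l: "inj l" and l': "inj l'"
    and a: "\<And>i. a i \<noteq> 0" and b: "\<And>i. b i \<noteq> 0"
    and \<epsilon>: "0 < \<epsilon>" and \<tau>: "\<And>i j. i \<noteq> j \<Longrightarrow> 2 * \<epsilon> \<le> cmod (\<tau> i - \<tau> j)"
begin

lemma swap: "chart_pair l' l b a \<epsilon> \<tau>"
  using m l l' a b \<epsilon> \<tau> by unfold_locales

definition "domain = chart l l' a b \<epsilon> \<tau> \<inter> diag_cone l"
definition "codomain = chart l' l b a \<epsilon> \<tau> \<inter> diag_cone l'"

context
  fixes x assumes x: "x \<in> domain"
begin

lemma nonzero: "x $ i \<noteq> 0"
  using x by (auto simp: domain_def chart_def sector_def dest!: spec[of _ i])

lemma degree_profile: "degree (profile l x) \<le> CARD('n)"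
  using degree_interp_cone[OF l, of "\<lambda>i. (x $ i)\<^sup>2"] x m
  by (simp add: domain_def diag_cone_def profile_def)

lemma target_pos: "0 < Re (target l l' b x i)"
  using x by (simp add: domain_def chart_def)

lemma branch_square: "(branch l l' b x $ i)\<^sup>2 = poly (profile l x) (l' i) / weight l' i"
  using b[of i] by (simp add: branch_def power_mult_distrib target_def)

lemma branch_nonzero: "branch l l' b x $ i \<noteq> 0"
  using b[of i] target_pos[of i] by (auto simp: branch_def)

lemma profile_branch: "profile l' (branch l l' b x) = profile l x"
  unfolding profile_def[of l']
  by (rule interp_eqI[OF l']) (use degree_profile m weight_nonzero[OF l'] in \<open>auto simp: branch_square\<close>)

lemma branch_mem_cone: "branch l l' b x \<in> diag_cone l'"
proof -
  let ?P = "profile l x"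
  have d: "degree ?P < CARD('m)" "degree ([:0, 1:] * ?P) < CARD('m)"
    using degree_profile m degree_mult_le[of "[:0, 1:]" ?P] by simp_all
  have "(\<Sum>i\<in>UNIV. poly ?P (l' i) / weight l' i) = 0"
    using divided_difference[OF l' d(1)] degree_profile m by (simp add: coeff_eq_0)
  moreover have "(\<Sum>i\<in>UNIV. l' i * (poly ?P (l' i) / weight l' i)) = 0"
    using divided_difference[OF l' d(2)] degree_profile m by (simp add: coeff_pCons coeff_eq_0 split: nat.splits)
  ultimately show ?thesis by (simp add: diag_cone_def branch_square)
qed

lemma target_branch: "target l' l a (branch l l' b x) i = (x $ i / a i)\<^sup>2"
  using a[of i] weight_nonzero[OF l, of i]
  by (simp add: target_def profile_branch poly_profile_node power_divide)

lemma branch_mem: "branch l l' b x \<in> codomain"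
proof -
  have "branch l l' b x $ i / b i \<in> sector" for i
    using b[of i] csqrt_mem_sector[OF target_pos] by (simp add: branch_def)
  moreover have "0 < Re (target l' l a (branch l l' b x) i)" for i
    unfolding target_branch using x by (intro Re_square_sector) (simp add: domain_def chart_def)
  ultimately show ?thesis
    using branch_mem_cone x by (simp add: codomain_def chart_def profile_branch domain_def)
qed

lemma branch_branch: "branch l' l a (branch l l' b x) = x"
proof -
  have "a i * csqrt ((x $ i / a i)\<^sup>2) = x $ i" for i
    using a[of i] x csqrt_square_sector[of "x $ i / a i"] by (simp add: domain_def chart_def)
  then show ?thesis by (simp add: branch_def[of l'] target_branch vec_eq_iff)
qed

text \<open>The map descends to projective space: for two vectors of the chart on the same line, the factor has
  positive real part, so no coordinate of the branch changes its sign.\<close>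

lemma branch_scale:
  assumes "c *s x \<in> domain" shows "branch l l' b (c *s x) = c *s branch l l' b x"
proof -
  obtain i :: 'm where True by blast
  have "x $ i / a i \<in> sector" "c * (x $ i / a i) \<in> sector"
    using x assms by (auto simp: domain_def chart_def)
  then have c: "0 < Re c" by (rule sector_ratio)
  have "0 < Re (target l l' b (c *s x) i)" for i
    using assms by (simp add: domain_def chart_def)
  then have "0 < Re (c\<^sup>2 * target l l' b x i)" for i by (simp only: target_scale)
  then show ?thesis
    by (simp add: branch_def target_scale vec_eq_iff csqrt_square_mult[OF target_pos _ c])
qed

text \<open>The point and its image interpolate the same polynomial, so that both have the second fundamental form
  given by its roots.\<close>

lemma common_roots:
  obtains t :: "'n \<Rightarrow> complex" and c where "point_over_roots l t c x" "point_over_roots l' t c (branch l l' b x)"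
proof -
  have "near_simple_roots \<epsilon> \<tau> (profile l x)" using x by (simp add: domain_def chart_def)
  from near_simple_roots_imp[OF this degree_profile \<epsilon> \<tau>]
  obtain t :: "'n \<Rightarrow> complex" and c where t: "inj t" "c \<noteq> 0" "profile l x = smult c (nodal UNIV t)" by metis
  have val: "poly (profile l x) z = c * poly (nodal UNIV t) z" for z by (simp add: t(3))
  have root: "poly (profile l x) (t k) = 0" for k by (auto simp: val poly_nodal_zero_iff)
  have "(x $ i)\<^sup>2 = c * poly (nodal UNIV t) (l i) / weight l i" for i
    using poly_profile_node[of l x i] weight_nonzero[OF l, of i] by (simp add: val)
  moreover have "l i \<noteq> t k" for i k
    using poly_profile_node[of l x i] root[of k] nonzero[of i] weight_nonzero[OF l, of i] by auto
  moreover have "(branch l l' b x $ i)\<^sup>2 = c * poly (nodal UNIV t) (l' i) / weight l' i" for i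
    by (simp add: branch_square val)
  moreover have "l' i \<noteq> t k" for i k
    using branch_square[of i] branch_nonzero[of i] root[of k] by auto
  ultimately show thesis using m l l' t by (intro that[of t c]) (unfold_locales; simp)+
qed

end

end


section \<open>Biholomorphic maps compatible with the moduli maps\<close>

locale chart_pair_spaces = chart_pair l l' a b \<epsilon> \<tau>
  for l l' a b :: "'m::finite \<Rightarrow> complex" and \<epsilon> and \<tau> :: "'n::finite \<Rightarrow> complex" +
  fixes X X' :: "(complex^'m) set set" and S S' :: "complex^'m^'m"
  assumes X: "diagonalizes S l X" and X': "diagonalizes S' l' X'"
begin

lemma swap_spaces: "chart_pair_spaces l' l b a \<epsilon> \<tau> X' X S' S"
  by (intro chart_pair_spaces.intro swap chart_pair_spaces_axioms.intro X X')

definition "patch = {vec.span {S *v x} | x. x \<in> domain}"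
definition "patch' = {vec.span {S' *v y} | y. y \<in> codomain}"

text \<open>The choice of a representative in the chart is immaterial by \<open>branch_scale\<close>.\<close>

definition transfer :: "(complex^'m) set \<Rightarrow> (complex^'m) set" where
  "transfer z = vec.span {S' *v branch l l' b (SOME x. x \<in> domain \<and> z = vec.span {S *v x})}"

lemma invertible_S: "invertible S"
  using X by (simp add: diagonalizes_def)

lemma S_zero_iff: "S *v v = 0 \<longleftrightarrow> v = 0"
  by (rule invertible_mult_zero_iff[OF invertible_S])

lemma S_eq_iff: "S *v u = S *v v \<longleftrightarrow> u = v"
  by (rule invertible_mult_eq_iff[OF invertible_S])

lemma domain_nonzero: "x \<in> domain \<Longrightarrow> x \<noteq> 0"
  using nonzero by (metis zero_index)

lemma transfer_eq:
  assumes x: "x \<in> domain"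
  shows "transfer (vec.span {S *v x}) = vec.span {S' *v branch l l' b x}"
proof -
  define x1 where "x1 = (SOME x'. x' \<in> domain \<and> vec.span {S *v x} = vec.span {S *v x'})"
  have "x1 \<in> domain \<and> vec.span {S *v x} = vec.span {S *v x1}"
    unfolding x1_def by (rule someI[of _ x]) (simp add: x)
  then have x1: "x1 \<in> domain" "vec.span {S *v x1} = vec.span {S *v x}" by auto
  then obtain c where c: "c \<noteq> 0" "S *v x1 = c *s (S *v x)"
    using span_singleton_vec_eq_iff[of "S *v x" "S *v x1"] domain_nonzero[OF x] S_zero_iff by auto
  then have "S *v x1 = S *v (c *s x)" by (simp add: vector_scalar_commute)
  then have "x1 = c *s x" by (simp only: S_eq_iff)
  then have "branch l l' b x1 = c *s branch l l' b x" using branch_scale[OF x] x1(1) by simp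
  moreover have "S' *v branch l l' b x \<noteq> 0"
    using X' branch_nonzero[OF x] invertible_mult_zero_iff[of S'] by (metis diagonalizes_def zero_index)
  ultimately have "vec.span {S' *v branch l l' b x1} = vec.span {S' *v branch l l' b x}"
    using c(1) by (subst span_singleton_vec_eq_iff) (auto simp: vector_scalar_commute)
  then show ?thesis unfolding transfer_def x1_def[symmetric] .
qed

lemma transfer_mem: "z \<in> patch \<Longrightarrow> transfer z \<in> patch'"
  using transfer_eq branch_mem unfolding patch_def patch'_def by blast

lemma moduli_map_transfer:
  assumes "z \<in> patch" and n: "2 \<le> CARD('n)"
  shows "z \<in> nonsingular_II_locus TYPE('n) X"
    and "(moduli_map X z :: (complex^'n^'n) set set) = moduli_map X' (transfer z)"
proof -
  obtain x where x: "z = vec.span {S *v x}" "x \<in> domain" using assms(1) by (auto simp: patch_def)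
  obtain t :: "'n \<Rightarrow> complex" and c where
    1: "point_over_roots l t c x" and 2: "point_over_roots l' t c (branch l l' b x)"
    using common_roots[OF x(2)] by blast
  show "z \<in> nonsingular_II_locus TYPE('n) X"
    unfolding x(1) by (rule point_over_roots.moduli_map_at_point(1)[OF 1 X n])
  show "(moduli_map X z :: (complex^'n^'n) set set) = moduli_map X' (transfer z)"
    unfolding x(1) transfer_eq[OF x(2)]
    by (simp only: point_over_roots.moduli_map_at_point(2)[OF 1 X n]
        point_over_roots.moduli_map_at_point(2)[OF 2 X' n])
qed

lemma span_mem_iff:
  assumes Q: "Q ** S = mat 1" "S ** Q = mat 1" and v: "v \<noteq> 0"
  shows "vec.span {v} \<in> {vec.span {S *v x} | x. x \<in> A \<and> x \<noteq> 0} \<longleftrightarrow>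
    (\<exists>c. c \<noteq> 0 \<and> mscale c Q *v v \<in> A)"
proof
  assume "vec.span {v} \<in> {vec.span {S *v x} | x. x \<in> A \<and> x \<noteq> 0}"
  then obtain x where x: "vec.span {v} = vec.span {S *v x}" "x \<in> A" "x \<noteq> 0" by blast
  then obtain c where c: "c \<noteq> 0" "v = c *s (S *v x)"
    using span_singleton_vec_eq_iff[of "S *v x" v] S_zero_iff by auto
  have "mscale (1 / c) Q *v v = (Q ** S) *v x"
    unfolding matrix_vector_mult_mscale unfolding c(2)
    using c(1) by (simp add: vector_scalar_commute vector_smult_assoc matrix_vector_mul_assoc)
  then have "mscale (1 / c) Q *v v \<in> A" using x(2) by (simp add: Q)
  then show "\<exists>c. c \<noteq> 0 \<and> mscale c Q *v v \<in> A" using c(1) by (intro exI[of _ "1 / c"]) simp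
next
  assume "\<exists>c. c \<noteq> 0 \<and> mscale c Q *v v \<in> A"
  then obtain c where c: "c \<noteq> 0" "mscale c Q *v v \<in> A" by blast
  have S: "S *v (mscale c Q *v v) = c *s v"
    by (simp add: matrix_vector_mult_mscale vector_scalar_commute matrix_vector_mul_assoc Q)
  then have "mscale c Q *v v \<noteq> 0" using c(1) v by auto
  moreover have "vec.span {v} = vec.span {S *v (mscale c Q *v v)}"
    unfolding S using c(1) v span_singleton_vec_eq_iff[of v "c *s v"] by auto
  ultimately show "vec.span {v} \<in> {vec.span {S *v x} | x. x \<in> A \<and> x \<noteq> 0}" using c(2) by blast
qed

lemma openin_patch: "openin (subtopology proj_euclidean X) patch"
proof -
  obtain Q where Q: "Q ** S = mat 1" "S ** Q = mat 1"
    using invertible_S by (auto simp: invertible_def)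
  let ?A = "chart l l' a b \<epsilon> \<tau>"
  define U where "U = {vec.span {S *v x} | x. x \<in> ?A \<and> x \<noteq> 0}"
  have U: "vec.span {v} \<in> U \<longleftrightarrow> (\<exists>c. c \<noteq> 0 \<and> mscale c Q *v v \<in> ?A)" if "v \<noteq> 0" for v
    unfolding U_def by (rule span_mem_iff[OF Q that])
  have eq: "{v \<in> - {0}. vec.span {v} \<in> U} = - {0} \<inter> (\<Union>c\<in>- {0}. (\<lambda>v. mscale c Q *v v) -` ?A)"
    by (auto simp: U)
  have "open ((\<lambda>v. mscale c Q *v v) -` ?A)" for c
    by (intro open_vimage open_chart linear_continuous_on matrix_vector_mul_bounded_linear)
  then have "openin (subtopology euclidean (- {0})) {v \<in> - {0}. vec.span {v} \<in> U}"
    unfolding eq by (intro openin_open_Int open_UN) auto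
  moreover have "U \<subseteq> (\<lambda>v. vec.span {v}) ` (- {0})"
    unfolding U_def using S_zero_iff by auto
  ultimately have "openin proj_euclidean U"
    by (simp add: proj_euclidean_def openin_quotient_topology)
  moreover have "patch = X \<inter> U"
  proof (intro equalityI subsetI)
    fix z assume "z \<in> patch"
    then obtain x where "z = vec.span {S *v x}" "x \<in> domain" by (auto simp: patch_def)
    then show "z \<in> X \<inter> U"
      using domain_nonzero[of x] diagonalizes_mem_iff[OF X, of x] by (auto simp: U_def domain_def)
  next
    fix z assume "z \<in> X \<inter> U"
    then obtain x where "z = vec.span {S *v x}" "x \<in> ?A" "x \<noteq> 0" "z \<in> X" by (auto simp: U_def)
    then show "z \<in> patch"
      using diagonalizes_mem_iff[OF X, of x] by (auto simp: patch_def domain_def)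
  qed
  ultimately show ?thesis by (auto simp: openin_subtopology)
qed

text \<open>Stated for any \<open>f\<close> with these values, since it is applied also to the inverse map.\<close>

lemma proj_holomorphic_transfer:
  assumes f: "\<And>x. x \<in> domain \<Longrightarrow> f (vec.span {S *v x}) = vec.span {S' *v branch l l' b x}"
  shows "proj_holomorphic patch f"
  unfolding proj_holomorphic_def
proof (intro allI impI, elim conjE)
  fix v :: "complex^'m" assume v: "v \<noteq> 0" "vec.span {v} \<in> patch"
  obtain Q where Q: "Q ** S = mat 1" "S ** Q = mat 1"
    using invertible_S by (auto simp: invertible_def)
  have patch: "patch = {vec.span {S *v x} | x. x \<in> domain \<and> x \<noteq> 0}"
    unfolding patch_def using domain_nonzero by blast
  obtain c where c: "c \<noteq> 0" "mscale c Q *v v \<in> domain"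
    using v span_mem_iff[OF Q v(1), of domain] unfolding patch by blast
  define R where "R = mscale c Q"
  define N where "N = {u. R *v u \<in> chart l l' a b \<epsilon> \<tau>}"
  define G where "G u = S' *v branch l l' b (R *v u)" for u
  have "open ((\<lambda>v. R *v v) -` chart l l' a b \<epsilon> \<tau>)"
    by (intro open_vimage open_chart linear_continuous_on matrix_vector_mul_bounded_linear)
  then have "open N" by (simp add: N_def vimage_def)
  moreover have "v \<in> N" using c(2) by (simp add: N_def R_def domain_def)
  moreover have "holomorphic_map N G"
    unfolding N_def G_def by (rule holomorphic_map_branch)
  moreover have "G u \<noteq> 0 \<and> f (vec.span {u}) = vec.span {G u}"
    if u: "u \<in> N" "u \<noteq> 0" "vec.span {u} \<in> patch" for u
  proof -
    have SR: "S *v (R *v u) = c *s u"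
      by (simp add: R_def matrix_vector_mult_mscale vector_scalar_commute matrix_vector_mul_assoc Q)
    then have span: "vec.span {S *v (R *v u)} = vec.span {u}"
      using c(1) u(2) span_singleton_vec_eq_iff[of u "c *s u"] by auto
    have "R *v u \<noteq> 0" using SR c(1) u(2) by auto
    moreover have "vec.span {u} \<in> X"
      using u(3) openin_subset[OF openin_patch] by auto
    ultimately have dom: "R *v u \<in> domain"
      using diagonalizes_mem_iff[OF X, of "R *v u"] u(1) span by (simp add: domain_def N_def)
    have "branch l l' b (R *v u) \<noteq> 0" using branch_nonzero[OF dom] by (metis zero_index)
    then have "G u \<noteq> 0"
      using X' invertible_mult_zero_iff[of S'] by (auto simp: G_def diagonalizes_def)
    moreover have "f (vec.span {u}) = vec.span {G u}"
      using f[OF dom] by (simp add: span G_def)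
    ultimately show ?thesis by blast
  qed
  ultimately show "\<exists>N G. open N \<and> v \<in> N \<and> holomorphic_map N G \<and>
      (\<forall>u\<in>N. u \<noteq> 0 \<and> vec.span {u} \<in> patch \<longrightarrow> G u \<noteq> 0 \<and> f (vec.span {u}) = vec.span {G u})"
    by blast
qed

text \<open>The inverse of the transfer map is the transfer map in the opposite direction.\<close>

interpretation sw: chart_pair_spaces l' l b a \<epsilon> \<tau> X' X S' S
  by (rule swap_spaces)

lemma sw_eq: "sw.domain = codomain" "sw.codomain = domain" "sw.patch = patch'" "sw.patch' = patch"
  unfolding sw.domain_def codomain_def sw.codomain_def domain_def
    sw.patch_def patch'_def sw.patch'_def patch_def by simp_all

lemma transfer_transfer: "z \<in> patch \<Longrightarrow> sw.transfer (transfer z) = z"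
  using transfer_eq sw.transfer_eq branch_mem branch_branch unfolding patch_def sw_eq by auto

lemma transfer_transfer': "z \<in> patch' \<Longrightarrow> transfer (sw.transfer z) = z"
  using transfer_eq sw.transfer_eq sw.branch_mem sw.branch_branch unfolding patch'_def sw_eq by auto

lemma bij_betw_transfer: "bij_betw transfer patch patch'"
  using transfer_mem sw.transfer_mem transfer_transfer transfer_transfer'
  unfolding sw_eq by (intro bij_betw_byWitness[where f' = sw.transfer]) auto

lemma biholomorphic_transfer: "biholomorphic_map patch patch' transfer"
proof -
  have "inv_into patch transfer (vec.span {S' *v y}) = vec.span {S *v branch l' l a y}" if y: "y \<in> sw.domain" for y
  proof -
    have "vec.span {S' *v y} \<in> patch'" using y by (auto simp: patch'_def sw_eq)
    then have "transfer (sw.transfer (vec.span {S' *v y})) = vec.span {S' *v y}"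
      "sw.transfer (vec.span {S' *v y}) \<in> patch"
      using transfer_transfer' sw.transfer_mem unfolding sw_eq by auto
    then have "inv_into patch transfer (vec.span {S' *v y}) = sw.transfer (vec.span {S' *v y})"
      using bij_betw_transfer by (metis bij_betw_imp_inj_on inv_into_f_f)
    then show ?thesis by (simp add: sw.transfer_eq[OF y])
  qed
  then have "proj_holomorphic patch' (inv_into patch transfer)"
    using sw.proj_holomorphic_transfer unfolding sw_eq by blast
  then show ?thesis
    using bij_betw_transfer proj_holomorphic_transfer[OF transfer_eq] by (simp add: biholomorphic_map_def)
qed

lemma openin_patch': "openin (subtopology proj_euclidean X') patch'"
  using sw.openin_patch unfolding sw_eq .

lemma patch'_subset:
  assumes "2 \<le> CARD('n)" shows "patch' \<subseteq> nonsingular_II_locus TYPE('n) X'"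
  using sw.moduli_map_transfer(1)[OF _ assms] unfolding sw_eq by blast

end

text \<open>Base points on both intersections are taken over one and the same set of roots \<open>\<tau>\<close>, spaced by integers
  and avoiding the nodes of both; all coordinates of the base points are then nonzero.\<close>

lemma biholomorphic_patches_exist:
  fixes X X' :: "(complex^'m) set set"
  assumes X: "diagonalizes S l X" and X': "diagonalizes S' l' X'"
    and m: "CARD('m) = CARD('n::finite) + 3" and n: "2 \<le> CARD('n)"
  shows "\<exists>M M' f. M \<noteq> {} \<and> M \<subseteq> nonsingular_II_locus TYPE('n) X \<and>
     openin (subtopology proj_euclidean X) M \<and>
     M' \<noteq> {} \<and> M' \<subseteq> nonsingular_II_locus TYPE('n) X' \<and>
     openin (subtopology proj_euclidean X') M' \<and>
     biholomorphic_map M M' f \<and>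
     (\<forall>x\<in>M. (moduli_map X x :: (complex^'n^'n) set set) = moduli_map X' (f x))"
proof -
  have l: "inj l" and l': "inj l'" using X X' by (auto simp: diagonalizes_def)
  obtain t0 :: "'n \<Rightarrow> nat" where t0: "inj t0" using finite_imp_inj_to_nat_seg[of "UNIV :: 'n set"] by auto
  define h where "h = (\<lambda>s :: 'm + 'm. case s of Inl i \<Rightarrow> l i | Inr i \<Rightarrow> l' i)"
  obtain s where s: "\<And>i k. h i \<noteq> of_nat (t0 k) + s" using shift_avoiding[of h "\<lambda>k. of_nat (t0 k)"] by blast
  define \<tau> where "\<tau> k = of_nat (t0 k) + s" for k
  have \<tau>: "inj \<tau>" using t0 by (simp add: \<tau>_def inj_def)
  have sep: "2 * (1 / 2) \<le> cmod (\<tau> i - \<tau> j)" if "i \<noteq> j" for i j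
  proof -
    have "t0 i \<noteq> t0 j" using that t0 by (auto dest: injD)
    then have "1 \<le> \<bar>int (t0 i) - int (t0 j)\<bar>" by linarith
    then have "1 \<le> real_of_int \<bar>int (t0 i) - int (t0 j)\<bar>" by linarith
    moreover have "\<tau> i - \<tau> j = of_int (int (t0 i) - int (t0 j))" by (simp add: \<tau>_def)
    ultimately have "1 \<le> cmod (\<tau> i - \<tau> j)" by (simp only: norm_of_int of_int_abs)
    then show ?thesis by simp
  qed
  have lt: "l i \<noteq> \<tau> k" "l' i \<noteq> \<tau> k" for i k
    using s[of "Inl i" k] s[of "Inr i" k] by (auto simp: h_def \<tau>_def)
  define x where "x = (\<chi> i. csqrt (poly (nodal UNIV \<tau>) (l i) / weight l i))"
  define y where "y = (\<chi> i. csqrt (poly (nodal UNIV \<tau>) (l' i) / weight l' i))"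
  interpret x: point_over_roots l \<tau> 1 x
    unfolding x_def by (intro point_over_roots_exists m l \<tau> lt)
  interpret y: point_over_roots l' \<tau> 1 y
    unfolding y_def by (intro point_over_roots_exists m l' \<tau> lt)
  interpret chart_pair_spaces l l' "\<lambda>i. x $ i" "\<lambda>i. y $ i" "1 / 2" \<tau> X X' S S'
    using m l l' x.y_nonzero y.y_nonzero sep X X' by unfold_locales auto
  have profile: "profile l x = nodal UNIV \<tau>"
    unfolding profile_def
    by (rule interp_eqI[OF l]) (use m weight_nonzero[OF l] in \<open>auto simp: x.y\<close>)
  have "target l l' (\<lambda>i. y $ i) x i = 1" for i
  proof -
    have "poly (nodal UNIV \<tau>) (l' i) = weight l' i * (y $ i)\<^sup>2"
      using weight_nonzero[OF l', of i] by (simp add: y.y)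
    then show ?thesis
      using weight_nonzero[OF l', of i] y.y_nonzero[of i] by (simp add: target_def profile)
  qed
  moreover have "near_simple_roots (1 / 2) \<tau> (nodal UNIV \<tau>)"
  proof -
    have "poly (nodal UNIV \<tau>) (\<tau> k) = 0" for k by (auto simp: poly_nodal_zero_iff)
    then show ?thesis using coeff_nodal_card[of UNIV \<tau>] by (simp add: near_simple_roots_def)
  qed
  ultimately have "x \<in> domain"
    using x.y_nonzero x.point_mem_cone(1) by (simp add: domain_def chart_def profile sector_def)
  then have ne: "patch \<noteq> {}" by (auto simp: patch_def)
  then have ne': "patch' \<noteq> {}" using transfer_mem by blast
  have "patch \<subseteq> nonsingular_II_locus TYPE('n) X"
    using moduli_map_transfer(1)[OF _ n] by (rule subsetI)
  then show ?thesis
    by (intro exI[of _ patch] exI[of _ patch'] exI[of _ transfer] conjI ballI ne ne' openin_patch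
        openin_patch' patch'_subset[OF n] biholomorphic_transfer moduli_map_transfer(2)[OF _ n])
qed

theorem theorem1p2:
  fixes X :: "(complex^'m) set set"
  assumes "3 \<le> CARD('n::finite)"
    and "CARD('m::finite) = CARD('n) + 3"
    and "nonsingular_intersection X"
  shows "dominant_map (nonsingular_II_locus TYPE('n) X) moduli_PQ
           (moduli_map X :: (complex^'m) set \<Rightarrow> (complex^'n^'n) set set) \<and>
         (\<forall>X' :: (complex^'m) set set. nonsingular_intersection X' \<longrightarrow>
            (\<exists>M M' f.
               M \<noteq> {} \<and> M \<subseteq> nonsingular_II_locus TYPE('n) X \<and>
               openin (subtopology proj_euclidean X) M \<and>
               M' \<noteq> {} \<and> M' \<subseteq> nonsingular_II_locus TYPE('n) X' \<and>
               openin (subtopology proj_euclidean X') M' \<and>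
               biholomorphic_map M M' f \<and>
               (\<forall>x\<in>M. (moduli_map X x :: (complex^'n^'n) set set) = moduli_map X' (f x))))"
proof (intro conjI allI impI)
  have n: "2 \<le> CARD('n)" using assms(1) by simp
  obtain S l where X: "diagonalizes S l X"
    using nonsingular_intersection_diagonalizable[OF assms(3)] by blast
  show "dominant_map (nonsingular_II_locus TYPE('n) X) moduli_PQ
      (moduli_map X :: (complex^'m) set \<Rightarrow> (complex^'n^'n) set set)"
    by (rule moduli_map_dominant[OF X assms(2) n])
  fix X' :: "(complex^'m) set set" assume "nonsingular_intersection X'"
  then obtain S' l' where X': "diagonalizes S' l' X'"
    using nonsingular_intersection_diagonalizable by blast
  show "\<exists>M M' f. M \<noteq> {} \<and> M \<subseteq> nonsingular_II_locus TYPE('n) X \<and>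
     openin (subtopology proj_euclidean X) M \<and>
     M' \<noteq> {} \<and> M' \<subseteq> nonsingular_II_locus TYPE('n) X' \<and>
     openin (subtopology proj_euclidean X') M' \<and>
     biholomorphic_map M M' f \<and>
     (\<forall>x\<in>M. (moduli_map X x :: (complex^'n^'n) set set) = moduli_map X' (f x))"
    by (rule biholomorphic_patches_exist[OF X X' assms(2) n])
qed

end
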